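(* Let $m,n\ge2$ and let $\Theta\in M_m(\mathbb R)$ and $\Psi\in M_n(\mathbb R)$ be skew-symmetric matrices. Let $M\in M_{n\times m}(\mathbb Z)$ and $z=(z_1,\dots,z_m)\in\mathbb T^m$. Assume that $\Theta\equiv M^t\Psi M \pmod{M_m(\mathbb Z)_{\mathrm{skew}}}$, i.e. that $\Theta-M^t\Psi M$ is an integer-valued skew-symmetric matrix. Then there is a unital $*$-homomorphism $\varphi_{M,z}\colon A_\Theta\to A_\Psi$ defined on generators by $$\varphi_{M,z}(U_j)=z_j\,V^{Me_j}=z_j\,V_1^{M_{1j}}\cdots V_n^{M_{nj}},\qquad 1\le j\le m,$$ where $U_1,\dots,U_m$ and $V_1,\dots,V_n$ are the canonical generators of $A_\Theta$ and $A_\Psi$ and $e_j$ is the $j$th standard basis vector of $\mathbb Z^m$. Conversely, if a $*$-homomorphism $\varphi\colon A_\Theta\to A_\Psi$ satisfies $\varphi(U_j)=z_jV^{Me_j}$ for all $1\le j\le m$, for some $M\in M_{n\times m}(\mathbb Z)$ and $z\in\mathbb T^m$, then $\Theta\equiv M^t\Psi M\pmod{M_m(\mathbb Z)_{\mathrm{skew}}}$.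
   Context: For $m\ge2$ and a skew-symmetric $\Theta\in M_m(\mathbb R)$, $A_\Theta$ is the universal unital $C^*$-algebra generated by unitaries $U_1,\dots,U_m$ (the canonical generators) with $U_kU_j=e^{2\pi i\Theta_{j,k}}U_jU_k$ for $1\le j,k\le m$. For $x\in\mathbb Z^m$, $U^x:=U_1^{x_1}\cdots U_m^{x_m}$ (similarly $V^y$ in $A_\Psi$). $\mathbb T$ is the unit circle in $\mathbb C$; $M_m(\mathbb Z)_{\mathrm{skew}}$ is the set of skew-symmetric integer $m\times m$ matrices. *)

theory Defs
  imports "HOL-Analysis.Elementary_Metric_Spaces" "HOL-Algebra.Module" "Jordan_Normal_Form.Matrix"
begin

text \<open>Unital $*$-algebras and $C^*$-algebras over the complex numbers, as structures with an
  explicit carrier. The library locale \<open>algebra\<close> is not used because it is commutative.\<close>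

record 'a star_algebra = "(complex, 'a) module" +
  star :: "'a \<Rightarrow> 'a"

record 'a cstar_algebra = "'a star_algebra" +
  cnorm :: "'a \<Rightarrow> real"

locale unital_star_algebra = ring A for A (structure) +
  assumes smult_closed: "x \<in> carrier A \<Longrightarrow> c \<odot> x \<in> carrier A"
    and smult_l_distr: "x \<in> carrier A \<Longrightarrow> (c + d) \<odot> x = c \<odot> x \<oplus> d \<odot> x"
    and smult_r_distr:
      "x \<in> carrier A \<Longrightarrow> y \<in> carrier A \<Longrightarrow> c \<odot> (x \<oplus> y) = c \<odot> x \<oplus> c \<odot> y"
    and smult_smult: "x \<in> carrier A \<Longrightarrow> c \<odot> (d \<odot> x) = (c * d) \<odot> x"
    and smult_one: "x \<in> carrier A \<Longrightarrow> 1 \<odot> x = x"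
    and smult_mult_left:
      "x \<in> carrier A \<Longrightarrow> y \<in> carrier A \<Longrightarrow> (c \<odot> x) \<otimes> y = c \<odot> (x \<otimes> y)"
    and smult_mult_right:
      "x \<in> carrier A \<Longrightarrow> y \<in> carrier A \<Longrightarrow> x \<otimes> (c \<odot> y) = c \<odot> (x \<otimes> y)"
    and star_closed: "x \<in> carrier A \<Longrightarrow> star A x \<in> carrier A"
    and star_star: "x \<in> carrier A \<Longrightarrow> star A (star A x) = x"
    and star_add:
      "x \<in> carrier A \<Longrightarrow> y \<in> carrier A \<Longrightarrow> star A (x \<oplus> y) = star A x \<oplus> star A y"
    and star_smult: "x \<in> carrier A \<Longrightarrow> star A (c \<odot> x) = cnj c \<odot> star A x"
    and star_mult:
      "x \<in> carrier A \<Longrightarrow> y \<in> carrier A \<Longrightarrow> star A (x \<otimes> y) = star A y \<otimes> star A x"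

definition cstar_seminorm :: "('a, 'b) star_algebra_scheme \<Rightarrow> ('a \<Rightarrow> real) \<Rightarrow> bool" where
  "cstar_seminorm A p \<longleftrightarrow>
     (\<forall>x\<in>carrier A. 0 \<le> p x) \<and>
     (\<forall>x\<in>carrier A. \<forall>c. p (c \<odot>\<^bsub>A\<^esub> x) = cmod c * p x) \<and>
     (\<forall>x\<in>carrier A. \<forall>y\<in>carrier A. p (x \<oplus>\<^bsub>A\<^esub> y) \<le> p x + p y) \<and>
     (\<forall>x\<in>carrier A. \<forall>y\<in>carrier A. p (x \<otimes>\<^bsub>A\<^esub> y) \<le> p x * p y) \<and>
     (\<forall>x\<in>carrier A. p (star A x \<otimes>\<^bsub>A\<^esub> x) = (p x)\<^sup>2)"

definition cauchy_seqs :: "('a, 'b) star_algebra_scheme \<Rightarrow> ('a \<Rightarrow> real) \<Rightarrow> (nat \<Rightarrow> 'a) set" where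
  "cauchy_seqs A p = {X. (\<forall>i. X i \<in> carrier A) \<and>
     (\<forall>e>0. \<exists>N. \<forall>i\<ge>N. \<forall>j\<ge>N. p (X i \<ominus>\<^bsub>A\<^esub> X j) < e)}"

locale unital_cstar_algebra = unital_star_algebra A for A (structure) +
  assumes cstar_seminorm: "cstar_seminorm A (cnorm A)"
    and cnorm_eq_0: "x \<in> carrier A \<Longrightarrow> cnorm A x = 0 \<Longrightarrow> x = \<zero>"
    and complete: "X \<in> cauchy_seqs A (cnorm A) \<Longrightarrow>
      \<exists>x\<in>carrier A. (\<lambda>i. cnorm A (X i \<ominus> x)) \<longlonglongrightarrow> 0"

definition star_hom :: "('a, 'c) star_algebra_scheme \<Rightarrow> ('b, 'd) star_algebra_scheme \<Rightarrow> ('a \<Rightarrow> 'b) set" where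
  "star_hom A B = {h. h \<in> carrier A \<rightarrow> carrier B \<and>
     (\<forall>x\<in>carrier A. \<forall>y\<in>carrier A. h (x \<oplus>\<^bsub>A\<^esub> y) = h x \<oplus>\<^bsub>B\<^esub> h y) \<and>
     (\<forall>x\<in>carrier A. \<forall>c. h (c \<odot>\<^bsub>A\<^esub> x) = c \<odot>\<^bsub>B\<^esub> h x) \<and>
     (\<forall>x\<in>carrier A. \<forall>y\<in>carrier A. h (x \<otimes>\<^bsub>A\<^esub> y) = h x \<otimes>\<^bsub>B\<^esub> h y) \<and>
     (\<forall>x\<in>carrier A. h (star A x) = star B (h x))}"

definition unital_star_hom :: "('a, 'c) star_algebra_scheme \<Rightarrow> ('b, 'd) star_algebra_scheme \<Rightarrow> ('a \<Rightarrow> 'b) set" where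
  "unital_star_hom A B = {h \<in> star_hom A B. h \<one>\<^bsub>A\<^esub> = \<one>\<^bsub>B\<^esub>}"

text \<open>Hausdorff completion of a $*$-algebra for a $C^*$-seminorm: Cauchy sequences modulo null
  sequences. Operations are those of representatives; the unions are over pairwise equal classes.\<close>

definition null_rel ::
    "('a, 'b) star_algebra_scheme \<Rightarrow> ('a \<Rightarrow> real) \<Rightarrow> ((nat \<Rightarrow> 'a) \<times> (nat \<Rightarrow> 'a)) set" where
  "null_rel A p = {(X, Y). X \<in> cauchy_seqs A p \<and> Y \<in> cauchy_seqs A p \<and>
     (\<lambda>i. p (X i \<ominus>\<^bsub>A\<^esub> Y i)) \<longlonglongrightarrow> 0}"

definition completion ::
    "('a, 'b) star_algebra_scheme \<Rightarrow> ('a \<Rightarrow> real) \<Rightarrow> (nat \<Rightarrow> 'a) set cstar_algebra" where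
  "completion A p =
    \<lparr> carrier = cauchy_seqs A p // null_rel A p,
      monoid.mult = (\<lambda>a b. \<Union>X\<in>a. \<Union>Y\<in>b. null_rel A p `` {\<lambda>i. X i \<otimes>\<^bsub>A\<^esub> Y i}),
      one = null_rel A p `` {\<lambda>i. \<one>\<^bsub>A\<^esub>},
      zero = null_rel A p `` {\<lambda>i. \<zero>\<^bsub>A\<^esub>},
      add = (\<lambda>a b. \<Union>X\<in>a. \<Union>Y\<in>b. null_rel A p `` {\<lambda>i. X i \<oplus>\<^bsub>A\<^esub> Y i}),
      smult = (\<lambda>c a. \<Union>X\<in>a. null_rel A p `` {\<lambda>i. c \<odot>\<^bsub>A\<^esub> X i}),
      star = (\<lambda>a. \<Union>X\<in>a. null_rel A p `` {\<lambda>i. star A (X i)}),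
      cnorm = (\<lambda>a. the_elem ((\<lambda>X. lim (\<lambda>i. p (X i))) ` a)) \<rparr>"

text \<open>The free unital $*$-algebra on \<open>x\<^sub>0, \<dots>, x\<^sub>m\<^sub>-\<^sub>1\<close>: finitely supported functions on the words
  in the letters \<open>(j, False)\<close>, standing for \<open>x\<^sub>j\<close>, and \<open>(j, True)\<close>, standing for \<open>x\<^sub>j\<^sup>*\<close>, where
  \<open>f w\<close> is the coefficient of the word \<open>w\<close>.\<close>

type_synonym word = "(nat \<times> bool) list"

definition free_star_algebra :: "nat \<Rightarrow> (word \<Rightarrow> complex) star_algebra" where
  "free_star_algebra m =
    \<lparr> carrier = {f. finite {w. f w \<noteq> 0} \<and> (\<forall>w. f w \<noteq> 0 \<longrightarrow> fst ` set w \<subseteq> {..<m})},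
      monoid.mult = (\<lambda>f g w. \<Sum>i\<le>length w. f (take i w) * g (drop i w)),
      one = (\<lambda>w. if w = [] then 1 else 0),
      zero = (\<lambda>w. 0),
      add = (\<lambda>f g w. f w + g w),
      smult = (\<lambda>c f w. c * f w),
      star = (\<lambda>f w. cnj (f (rev (map (apsnd Not) w)))) \<rparr>"

definition free_gen :: "nat \<Rightarrow> word \<Rightarrow> complex" where
  "free_gen j = (\<lambda>w. if w = [(j, False)] then 1 else 0)"

text \<open>The universal unital $C^*$-algebra on \<open>m\<close> generators subject to the relations \<open>r = 0\<close>,
  \<open>r \<in> R\<close>: the completion of the free unital $*$-algebra in the largest $C^*$-seminorm vanishing
  on \<open>R\<close>. It exists only if that supremum is finite, for instance if \<open>R\<close> makes the generators
  unitary.\<close>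

definition universal_seminorm :: "nat \<Rightarrow> (word \<Rightarrow> complex) set \<Rightarrow> (word \<Rightarrow> complex) \<Rightarrow> real" where
  "universal_seminorm m R f =
     (SUP p\<in>{p. cstar_seminorm (free_star_algebra m) p \<and> (\<forall>r\<in>R. p r = 0)}. p f)"

definition universal_cstar :: "nat \<Rightarrow> (word \<Rightarrow> complex) set \<Rightarrow> (nat \<Rightarrow> word \<Rightarrow> complex) set cstar_algebra" where
  "universal_cstar m R = completion (free_star_algebra m) (universal_seminorm m R)"

definition universal_gen :: "nat \<Rightarrow> (word \<Rightarrow> complex) set \<Rightarrow> nat \<Rightarrow> (nat \<Rightarrow> word \<Rightarrow> complex) set" where
  "universal_gen m R j =
     null_rel (free_star_algebra m) (universal_seminorm m R) `` {\<lambda>i. free_gen j}"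

text \<open>Noncommutative tori. Indices start at \<open>0\<close>.\<close>

definition torus_relations :: "real mat \<Rightarrow> (word \<Rightarrow> complex) set" where
  "torus_relations \<Theta> = (let m = dim_row \<Theta>; F = free_star_algebra m; u = free_gen in
     {star F (u j) \<otimes>\<^bsub>F\<^esub> u j \<ominus>\<^bsub>F\<^esub> \<one>\<^bsub>F\<^esub> | j. j < m} \<union>
     {u j \<otimes>\<^bsub>F\<^esub> star F (u j) \<ominus>\<^bsub>F\<^esub> \<one>\<^bsub>F\<^esub> | j. j < m} \<union>
     {u k \<otimes>\<^bsub>F\<^esub> u j \<ominus>\<^bsub>F\<^esub> exp (2 * pi * \<i> * \<Theta> $$ (j, k)) \<odot>\<^bsub>F\<^esub> (u j \<otimes>\<^bsub>F\<^esub> u k) | j k. j < m \<and> k < m})"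

definition nc_torus :: "real mat \<Rightarrow> (nat \<Rightarrow> word \<Rightarrow> complex) set cstar_algebra" where
  "nc_torus \<Theta> = universal_cstar (dim_row \<Theta>) (torus_relations \<Theta>)"

definition torus_gen :: "real mat \<Rightarrow> nat \<Rightarrow> (nat \<Rightarrow> word \<Rightarrow> complex) set" where
  "torus_gen \<Theta> = universal_gen (dim_row \<Theta>) (torus_relations \<Theta>)"

text \<open>The ordered monomial \<open>U\<^sub>0\<^bsup>x\<^sub>0\<^esup> \<cdots> U\<^sub>m\<^sub>-\<^sub>1\<^bsup>x\<^sub>m\<^sub>-\<^sub>1\<^esup>\<close>.\<close>

definition torus_monom :: "real mat \<Rightarrow> int vec \<Rightarrow> (nat \<Rightarrow> word \<Rightarrow> complex) set" where
  "torus_monom \<Theta> x = foldr (\<otimes>\<^bsub>nc_torus \<Theta>\<^esub>)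
     (map (\<lambda>j. torus_gen \<Theta> j [^]\<^bsub>nc_torus \<Theta>\<^esub> (x $ j)) [0..<dim_row \<Theta>]) \<one>\<^bsub>nc_torus \<Theta>\<^esub>"

definition skew_mats :: "nat \<Rightarrow> 'a::ring_1 mat set" where
  "skew_mats m = {A \<in> carrier_mat m m. transpose_mat A = - A}"

definition cong_skew :: "nat \<Rightarrow> real mat \<Rightarrow> real mat \<Rightarrow> bool" where
  "cong_skew m A B \<longleftrightarrow> (\<exists>N \<in> skew_mats m. A - B = map_mat real_of_int N)"

text \<open>The rest of this theory shows that \<open>nc_torus \<Theta>\<close> has the defining universal property: it is a
  unital $C^*$-algebra (\<open>nc_torus_cstar\<close>), its generators are unitaries satisfying the commutation
  relations (\<open>nc_torus_relations\<close>), and such unitaries in a unital $C^*$-algebra over any type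
  are images of the generators under a unital $*$-homomorphism (\<open>nc_torus_universal\<close>).\<close>

subsection \<open>Completions\<close>

context unital_star_algebra
begin

lemma smult_zero: "x \<in> carrier A \<Longrightarrow> 0 \<odot> x = \<zero>"
proof -
  assume x: "x \<in> carrier A"
  have "0 \<odot> x \<oplus> 0 \<odot> x = 0 \<odot> x" using smult_l_distr[OF x, of 0 0] by simp
  then show ?thesis using smult_closed[OF x, of 0]
    using add.r_cancel_one by blast
qed

lemma smult_minus_one: "x \<in> carrier A \<Longrightarrow> \<ominus> x = (-1) \<odot> x"
proof -
  assume x: "x \<in> carrier A"
  have "(-1) \<odot> x \<oplus> x = \<zero>" using smult_l_distr[OF x, of "-1" 1] by (simp add: smult_zero smult_one x)
  then show ?thesis using minus_equality smult_closed x by blast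
qed

lemma star_minus: "x \<in> carrier A \<Longrightarrow> y \<in> carrier A \<Longrightarrow> star A (x \<ominus> y) = star A x \<ominus> star A y"
  by (simp add: a_minus_def star_add smult_minus_one smult_closed star_smult star_closed)

lemma smult_minus: "x \<in> carrier A \<Longrightarrow> y \<in> carrier A \<Longrightarrow> c \<odot> (x \<ominus> y) = c \<odot> x \<ominus> c \<odot> y"
  by (simp add: a_minus_def smult_r_distr smult_minus_one smult_closed smult_smult mult.commute)

lemma diff_trans:
  "x \<in> carrier A \<Longrightarrow> y \<in> carrier A \<Longrightarrow> z \<in> carrier A \<Longrightarrow> x \<ominus> z = (x \<ominus> y) \<oplus> (y \<ominus> z)"
  by algebra

lemma diff_add:
  "x \<in> carrier A \<Longrightarrow> y \<in> carrier A \<Longrightarrow> x' \<in> carrier A \<Longrightarrow> y' \<in> carrier A \<Longrightarrow>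
   (x \<oplus> y) \<ominus> (x' \<oplus> y') = (x \<ominus> x') \<oplus> (y \<ominus> y')"
  by algebra

lemma diff_mult:
  "x \<in> carrier A \<Longrightarrow> y \<in> carrier A \<Longrightarrow> x' \<in> carrier A \<Longrightarrow> y' \<in> carrier A \<Longrightarrow>
   (x \<otimes> y) \<ominus> (x' \<otimes> y') = x \<otimes> (y \<ominus> y') \<oplus> (x \<ominus> x') \<otimes> y'"
  by algebra

end

locale seminormed_star_algebra = unital_star_algebra A for A (structure) +
  fixes p :: "'a \<Rightarrow> real"
  assumes cstar_seminorm: "cstar_seminorm A p"
begin

lemma p_nonneg: "x \<in> carrier A \<Longrightarrow> 0 \<le> p x"
  and p_smult: "x \<in> carrier A \<Longrightarrow> p (c \<odot> x) = cmod c * p x"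
  and p_add: "x \<in> carrier A \<Longrightarrow> y \<in> carrier A \<Longrightarrow> p (x \<oplus> y) \<le> p x + p y"
  and p_mult: "x \<in> carrier A \<Longrightarrow> y \<in> carrier A \<Longrightarrow> p (x \<otimes> y) \<le> p x * p y"
  and p_cstar: "x \<in> carrier A \<Longrightarrow> p (star A x \<otimes> x) = (p x)\<^sup>2"
  using cstar_seminorm unfolding cstar_seminorm_def by blast+

lemma p_zero [simp]: "p \<zero> = 0"
  using p_smult[of \<zero> 0] smult_zero[of \<zero>] by simp

lemma p_minus: "x \<in> carrier A \<Longrightarrow> p (\<ominus> x) = p x"
  by (simp add: smult_minus_one p_smult)

lemma p_diff_self [simp]: "x \<in> carrier A \<Longrightarrow> p (x \<ominus> x) = 0"
  by (simp add: a_minus_def r_neg)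

lemma p_diff_commute: "x \<in> carrier A \<Longrightarrow> y \<in> carrier A \<Longrightarrow> p (x \<ominus> y) = p (y \<ominus> x)"
proof -
  assume xy: "x \<in> carrier A" "y \<in> carrier A"
  have "x \<ominus> y = \<ominus> (y \<ominus> x)" using xy by algebra
  then show ?thesis using xy p_minus by simp
qed

lemma p_diff_triangle: "x \<in> carrier A \<Longrightarrow> y \<in> carrier A \<Longrightarrow> z \<in> carrier A \<Longrightarrow>
   p (x \<ominus> z) \<le> p (x \<ominus> y) + p (y \<ominus> z)"
  by (subst diff_trans[of x y z]) (auto intro: p_add)

lemma p_diff_abs: "x \<in> carrier A \<Longrightarrow> y \<in> carrier A \<Longrightarrow> \<bar>p x - p y\<bar> \<le> p (x \<ominus> y)"
proof -
  assume xy: "x \<in> carrier A" "y \<in> carrier A"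
  have "x \<ominus> \<zero> = x" "y \<ominus> \<zero> = y" using xy by algebra+
  then show ?thesis
    using p_diff_triangle[of x y \<zero>] p_diff_triangle[of y x \<zero>] p_diff_commute[of x y] xy by auto
qed

lemma p_star: assumes "x \<in> carrier A" shows "p (star A x) = p x"
proof -
  have le: "p x \<le> p (star A x)" if x: "x \<in> carrier A" for x
  proof (cases "p x = 0")
    case True then show ?thesis using p_nonneg star_closed x by simp
  next
    case False
    have "(p x)\<^sup>2 \<le> p (star A x) * p x" using p_cstar[OF x] p_mult[OF star_closed[OF x] x] by simp
    then show ?thesis using False p_nonneg[OF x] by (simp add: power2_eq_square)
  qed
  show ?thesis using le[OF assms] le[OF star_closed[OF assms]] star_star[OF assms] by simp
qed

abbreviation "C \<equiv> cauchy_seqs A p"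
abbreviation "N \<equiv> null_rel A p"

lemma C_carrier: "X \<in> C \<Longrightarrow> X i \<in> carrier A"
  by (simp add: cauchy_seqs_def)

lemma C_I: "(\<And>i. X i \<in> carrier A) \<Longrightarrow> 
  (\<And>e. e > 0 \<Longrightarrow> \<exists>N. \<forall>i\<ge>N. \<forall>j\<ge>N. p (X i \<ominus> X j) < e) \<Longrightarrow> X \<in> C"
  by (simp add: cauchy_seqs_def)

lemma C_D: "X \<in> C \<Longrightarrow> e > 0 \<Longrightarrow> \<exists>N. \<forall>i\<ge>N. \<forall>j\<ge>N. p (X i \<ominus> X j) < e"
  by (simp add: cauchy_seqs_def)

lemma C_const: "x \<in> carrier A \<Longrightarrow> (\<lambda>i. x) \<in> C"
  by (auto intro!: C_I)

lemma C_norm_Cauchy: assumes "X \<in> C" shows "Cauchy (\<lambda>i. p (X i))"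
proof (rule CauchyI)
  fix e :: real assume "e > 0"
  then obtain K where K: "\<forall>i\<ge>K. \<forall>j\<ge>K. p (X i \<ominus> X j) < e" using C_D assms by blast
  have "\<bar>p (X i) - p (X j)\<bar> < e" if "i \<ge> K" "j \<ge> K" for i j
    using p_diff_abs[OF C_carrier[OF assms] C_carrier[OF assms], of i j] K that by fastforce
  then show "\<exists>M. \<forall>m\<ge>M. \<forall>n\<ge>M. norm (p (X m) - p (X n)) < e" by auto
qed

lemma C_norm_lim: "X \<in> C \<Longrightarrow> (\<lambda>i. p (X i)) \<longlonglongrightarrow> lim (\<lambda>i. p (X i))"
  using C_norm_Cauchy Cauchy_convergent convergent_LIMSEQ_iff by blast

lemma C_bounded: assumes "X \<in> C" obtains B where "B > 0" "\<And>i. p (X i) \<le> B"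
proof -
  obtain B where "B > 0" "\<forall>i. norm (p (X i)) \<le> B"
    using Cauchy_Bseq[OF C_norm_Cauchy[OF assms]] by (auto simp: Bseq_def)
  then show ?thesis using that by (metis abs_le_D1 real_norm_def)
qed

lemma C_lipschitz:
  assumes X: "X \<in> C" and K: "K \<ge> 0" and Z: "\<And>i. Z i \<in> carrier A"
   and le: "\<And>i j. p (Z i \<ominus> Z j) \<le> K * p (X i \<ominus> X j)"
  shows "Z \<in> C"
proof (rule C_I[OF Z])
  fix e :: real assume e: "e > 0"
  then have "e / (K + 1) > 0" using K by simp
  then obtain M where M: "\<forall>i\<ge>M. \<forall>j\<ge>M. p (X i \<ominus> X j) < e / (K+1)" using C_D X by blast
  have "p (Z i \<ominus> Z j) < e" if "i \<ge> M" "j \<ge> M" for i j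
  proof -
    have "0 \<le> p (X i \<ominus> X j)" using C_carrier[OF X] p_nonneg by simp
    then have "p (Z i \<ominus> Z j) \<le> (K+1) * p (X i \<ominus> X j)" using le[of i j] by (simp add: algebra_simps)
    also have "\<dots> < (K+1) * (e/(K+1))" using M that K by (intro mult_strict_left_mono) auto
    finally show ?thesis using K by simp
  qed
  then show "\<exists>N. \<forall>i\<ge>N. \<forall>j\<ge>N. p (Z i \<ominus> Z j) < e" by blast
qed

lemma C_lipschitz2:
  assumes X: "X \<in> C" and Y: "Y \<in> C" and K: "K > 0" and Z: "\<And>i. Z i \<in> carrier A"
   and le: "\<And>i j. p (Z i \<ominus> Z j) \<le> K * p (X i \<ominus> X j) + K * p (Y i \<ominus> Y j)"
  shows "Z \<in> C"
proof (rule C_I[OF Z])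
  fix e :: real assume e: "e > 0"
  then have e': "e / (2*K) > 0" using K by simp
  then obtain M where M: "\<forall>i\<ge>M. \<forall>j\<ge>M. p (X i \<ominus> X j) < e / (2*K)" using C_D X by blast
  obtain L where L: "\<forall>i\<ge>L. \<forall>j\<ge>L. p (Y i \<ominus> Y j) < e / (2*K)" using C_D Y e' by blast
  have "p (Z i \<ominus> Z j) < e" if ij: "i \<ge> max L M" "j \<ge> max L M" for i j
  proof -
    have "K * p (X i \<ominus> X j) < K * (e / (2*K))" using M ij K by (intro mult_strict_left_mono) auto
    moreover have "K * p (Y i \<ominus> Y j) < K * (e / (2*K))" using L ij K by (intro mult_strict_left_mono) auto
    ultimately have "K * p (X i \<ominus> X j) + K * p (Y i \<ominus> Y j) < e" using K by simp
    then show ?thesis using le[of i j] by simp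
  qed
  then show "\<exists>N. \<forall>i\<ge>N. \<forall>j\<ge>N. p (Z i \<ominus> Z j) < e" by blast
qed

lemma C_add: assumes X: "X \<in> C" and Y: "Y \<in> C" shows "(\<lambda>i. X i \<oplus> Y i) \<in> C"
  using C_carrier[OF X] C_carrier[OF Y]
  by (intro C_lipschitz2[OF X Y, of 1]) (auto simp: diff_add intro!: p_add)

lemma C_smult: assumes X: "X \<in> C" shows "(\<lambda>i. c \<odot> X i) \<in> C"
  using C_carrier[OF X]
  by (intro C_lipschitz[OF X, of "cmod c"]) (auto simp: smult_closed smult_minus[symmetric] p_smult)

lemma C_star: assumes X: "X \<in> C" shows "(\<lambda>i. star A (X i)) \<in> C"
  using C_carrier[OF X]
  by (intro C_lipschitz[OF X, of 1]) (auto simp: star_closed star_minus[symmetric] p_star)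

lemma C_diff: assumes X: "X \<in> C" and Y: "Y \<in> C" shows "(\<lambda>i. X i \<ominus> Y i) \<in> C"
proof -
  have "(\<lambda>i. X i \<ominus> Y i) = (\<lambda>i. X i \<oplus> (-1) \<odot> Y i)"
    using C_carrier[OF Y] by (simp add: a_minus_def smult_minus_one)
  then show ?thesis using C_add C_smult X Y by simp
qed

lemma p_diff_mult:
  assumes "x \<in> carrier A" "y \<in> carrier A" "x' \<in> carrier A" "y' \<in> carrier A" "p x \<le> K" "p y' \<le> K"
  shows "p (x \<otimes> y \<ominus> x' \<otimes> y') \<le> K * p (x \<ominus> x') + K * p (y \<ominus> y')"
proof -
  have "p (x \<otimes> y \<ominus> x' \<otimes> y') \<le> p (x \<otimes> (y \<ominus> y')) + p ((x \<ominus> x') \<otimes> y')"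
    using assms by (simp add: diff_mult p_add)
  also have "\<dots> \<le> p x * p (y \<ominus> y') + p (x \<ominus> x') * p y'"
    using assms by (intro add_mono p_mult) auto
  also have "\<dots> \<le> K * p (y \<ominus> y') + p (x \<ominus> x') * K"
    using assms p_nonneg by (intro add_mono mult_right_mono mult_left_mono) auto
  finally show ?thesis by (simp add: algebra_simps)
qed

lemma C_mult: assumes X: "X \<in> C" and Y: "Y \<in> C" shows "(\<lambda>i. X i \<otimes> Y i) \<in> C"
proof -
  obtain B1 where B1: "B1 > 0" "\<And>i. p (X i) \<le> B1" using C_bounded[OF X] by blast
  obtain B2 where B2: "B2 > 0" "\<And>i. p (Y i) \<le> B2" using C_bounded[OF Y] by blast
  show ?thesis using C_carrier[OF X] C_carrier[OF Y] B1 B2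
    by (intro C_lipschitz2[OF X Y, of "max B1 B2"] p_diff_mult) (auto intro: le_max_iff_disj[THEN iffD2])
qed

lemma squeeze0:
  fixes f g :: "nat \<Rightarrow> real"
  assumes "g \<longlonglongrightarrow> 0" "\<And>i. 0 \<le> f i" "\<And>i. f i \<le> g i" shows "f \<longlonglongrightarrow> 0"
  by (rule tendsto_sandwich[OF always_eventually always_eventually tendsto_const assms(1)]) (use assms in auto)

lemma N_iff: "(X, Y) \<in> N \<longleftrightarrow> X \<in> C \<and> Y \<in> C \<and> (\<lambda>i. p (X i \<ominus> Y i)) \<longlonglongrightarrow> 0"
  by (simp add: null_rel_def)

lemma equiv_N: "equiv C N"
proof (rule equivI)
  show "N \<subseteq> C \<times> C" by (auto simp: null_rel_def)
  show "refl_on C N" by (auto simp: refl_on_def null_rel_def C_carrier)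
  show "sym N"
  proof (rule symI)
    fix X Y assume "(X, Y) \<in> N"
    then have "p (X i \<ominus> Y i) = p (Y i \<ominus> X i)" for i by (intro p_diff_commute) (auto simp: N_iff C_carrier)
    then show "(Y, X) \<in> N" using \<open>(X, Y) \<in> N\<close> by (simp add: N_iff)
  qed
  show "trans N"
  proof (rule transI)
    fix X Y Z assume a: "(X, Y) \<in> N" "(Y, Z) \<in> N"
    then have "(\<lambda>i. p (X i \<ominus> Y i) + p (Y i \<ominus> Z i)) \<longlonglongrightarrow> 0 + 0" unfolding N_iff by (intro tendsto_add) auto
    moreover have c: "X i \<in> carrier A" "Y i \<in> carrier A" "Z i \<in> carrier A" for i
      using a C_carrier by (auto simp: N_iff)
    ultimately have "(\<lambda>i. p (X i \<ominus> Z i)) \<longlonglongrightarrow> 0"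
      by (intro squeeze0[where f="\<lambda>i. p (X i \<ominus> Z i)" and g="\<lambda>i. p (X i \<ominus> Y i) + p (Y i \<ominus> Z i)"] p_nonneg p_diff_triangle minus_closed c) simp_all
    then show "(X, Z) \<in> N" using a by (simp add: N_iff)
  qed
qed

lemma N_I_lipschitz:
  assumes "(X, X') \<in> N" "Z \<in> C" "Z' \<in> C" "\<And>i. p (Z i \<ominus> Z' i) \<le> K * p (X i \<ominus> X' i)"
  shows "(Z, Z') \<in> N"
proof -
  have "(\<lambda>i. K * p (X i \<ominus> X' i)) \<longlonglongrightarrow> K * 0" using assms by (intro tendsto_mult) (auto simp: N_iff)
  then have "(\<lambda>i. p (Z i \<ominus> Z' i)) \<longlonglongrightarrow> 0"
    by (intro squeeze0[where f="\<lambda>i. p (Z i \<ominus> Z' i)" and g="\<lambda>i. K * p (X i \<ominus> X' i)"] assms p_nonneg minus_closed C_carrier[OF assms(2)] C_carrier[OF assms(3)]) simp_all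
  then show ?thesis using assms by (simp add: N_iff)
qed

lemma N_I_lipschitz2:
  assumes "(X, X') \<in> N" "(Y, Y') \<in> N" "Z \<in> C" "Z' \<in> C"
    "\<And>i. p (Z i \<ominus> Z' i) \<le> K * p (X i \<ominus> X' i) + K * p (Y i \<ominus> Y' i)"
  shows "(Z, Z') \<in> N"
proof -
  have "(\<lambda>i. K * p (X i \<ominus> X' i) + K * p (Y i \<ominus> Y' i)) \<longlonglongrightarrow> K * 0 + K * 0"
    using assms by (intro tendsto_mult tendsto_add) (auto simp: N_iff)
  then have "(\<lambda>i. p (Z i \<ominus> Z' i)) \<longlonglongrightarrow> 0"
    by (intro squeeze0[where f="\<lambda>i. p (Z i \<ominus> Z' i)" and g="\<lambda>i. K * p (X i \<ominus> X' i) + K * p (Y i \<ominus> Y' i)"] assms p_nonneg minus_closed C_carrier[OF assms(3)] C_carrier[OF assms(4)]) simp_all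
  then show ?thesis using assms by (simp add: N_iff)
qed

lemma N_add: assumes "(X, X') \<in> N" "(Y, Y') \<in> N"
  shows "(\<lambda>i. X i \<oplus> Y i, \<lambda>i. X' i \<oplus> Y' i) \<in> N"
  using assms by (intro N_I_lipschitz2[OF assms, of _ _ 1] C_add) (auto simp: N_iff C_carrier diff_add intro!: p_add)

lemma N_smult: assumes "(X, X') \<in> N" shows "(\<lambda>i. c \<odot> X i, \<lambda>i. c \<odot> X' i) \<in> N"
  using assms by (intro N_I_lipschitz[OF assms, of _ _ "cmod c"] C_smult)
   (auto simp: N_iff C_carrier smult_minus[symmetric] p_smult)

lemma N_star: assumes "(X, X') \<in> N" shows "(\<lambda>i. star A (X i), \<lambda>i. star A (X' i)) \<in> N"
  using assms by (intro N_I_lipschitz[OF assms, of _ _ 1] C_star)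
   (auto simp: N_iff C_carrier star_minus[symmetric] p_star)

lemma N_mult: assumes "(X, X') \<in> N" "(Y, Y') \<in> N"
  shows "(\<lambda>i. X i \<otimes> Y i, \<lambda>i. X' i \<otimes> Y' i) \<in> N"
proof -
  have X: "X \<in> C" "X' \<in> C" "Y \<in> C" "Y' \<in> C" using assms by (auto simp: N_iff)
  obtain B1 where B1: "B1 > 0" "\<And>i. p (X i) \<le> B1" using C_bounded[OF X(1)] by blast
  obtain B2 where B2: "B2 > 0" "\<And>i. p (Y' i) \<le> B2" using C_bounded[OF X(4)] by blast
  show ?thesis using X B1 B2
    by (intro N_I_lipschitz2[OF assms, of _ _ "max B1 B2"] C_mult p_diff_mult) 
       (auto simp: C_carrier intro: le_max_iff_disj[THEN iffD2])
qed

lemma N_norm: assumes "(X, X') \<in> N" shows "lim (\<lambda>i. p (X i)) = lim (\<lambda>i. p (X' i))"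
proof -
  have X: "X \<in> C" "X' \<in> C" using assms by (auto simp: N_iff)
  have "(\<lambda>i. p (X i) - p (X' i)) \<longlonglongrightarrow> 0"
  proof (rule tendsto_rabs_zero_cancel, rule squeeze0)
    show "(\<lambda>i. p (X i \<ominus> X' i)) \<longlonglongrightarrow> 0" using assms by (simp add: N_iff)
  qed (use X p_diff_abs C_carrier in auto)
  moreover have "(\<lambda>i. p (X i) - p (X' i)) \<longlonglongrightarrow> lim (\<lambda>i. p (X i)) - lim (\<lambda>i. p (X' i))"
    using X by (intro tendsto_diff C_norm_lim)
  ultimately show ?thesis using LIMSEQ_unique by fastforce
qed

abbreviation "cls X \<equiv> N `` {X}"
abbreviation "Q \<equiv> completion A p"

lemma cls_eq_iff: "X \<in> C \<Longrightarrow> Y \<in> C \<Longrightarrow> cls X = cls Y \<longleftrightarrow> (X, Y) \<in> N"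
  using equiv_N eq_equiv_class_iff by metis

lemma carrier_Q: "a \<in> carrier Q \<longleftrightarrow> (\<exists>X\<in>C. a = cls X)"
  by (auto simp: completion_def quotient_def)

lemma carrier_Q_E: assumes "a \<in> carrier Q" obtains X where "X \<in> C" "a = cls X"
  using assms carrier_Q by blast

lemma cls_in_Q: "X \<in> C \<Longrightarrow> cls X \<in> carrier Q" using carrier_Q by blast

lemma Q_mult: "X \<in> C \<Longrightarrow> Y \<in> C \<Longrightarrow> cls X \<otimes>\<^bsub>Q\<^esub> cls Y = cls (\<lambda>i. X i \<otimes> Y i)"
  unfolding completion_def monoid.simps
  by (rule UN_equiv_class2[OF equiv_N equiv_N]) (auto simp only: congruent2_def intro!: equiv_class_eq[OF equiv_N] N_mult)

lemma Q_add: "X \<in> C \<Longrightarrow> Y \<in> C \<Longrightarrow> cls X \<oplus>\<^bsub>Q\<^esub> cls Y = cls (\<lambda>i. X i \<oplus> Y i)"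
  unfolding completion_def ring.simps
  by (rule UN_equiv_class2[OF equiv_N equiv_N]) (auto simp only: congruent2_def intro!: equiv_class_eq[OF equiv_N] N_add)

lemma Q_smult: "X \<in> C \<Longrightarrow> c \<odot>\<^bsub>Q\<^esub> cls X = cls (\<lambda>i. c \<odot> X i)"
  unfolding completion_def module.simps
  by (rule UN_equiv_class[OF equiv_N]) (auto simp only: congruent_def intro!: equiv_class_eq[OF equiv_N] N_smult)

lemma Q_star: "X \<in> C \<Longrightarrow> star Q (cls X) = cls (\<lambda>i. star A (X i))"
  unfolding completion_def star_algebra.simps
  by (rule UN_equiv_class[OF equiv_N]) (auto simp only: congruent_def intro!: equiv_class_eq[OF equiv_N] N_star)

lemma Q_norm: assumes X: "X \<in> C" shows "cnorm Q (cls X) = lim (\<lambda>i. p (X i))"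
proof -
  have "X \<in> cls X" by (rule equiv_class_self[OF equiv_N X])
  then have "(\<lambda>X. lim (\<lambda>i. p (X i))) ` cls X = {lim (\<lambda>i. p (X i))}"
  proof -
    have "(\<lambda>Y. lim (\<lambda>i. p (Y i))) ` cls X = (\<lambda>_. lim (\<lambda>i. p (X i))) ` cls X"
      by (rule image_cong[OF refl]) (rule N_norm[symmetric], rule Image_singleton_iff[THEN iffD1])
    also have "\<dots> = {lim (\<lambda>i. p (X i))}" by (rule image_constant) fact
    finally show ?thesis .
  qed
  then show ?thesis by (simp add: completion_def)
qed

lemma Q_one: "\<one>\<^bsub>Q\<^esub> = cls (\<lambda>i. \<one>)" by (simp add: completion_def)
lemma Q_zero: "\<zero>\<^bsub>Q\<^esub> = cls (\<lambda>i. \<zero>)" by (simp add: completion_def)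

lemma Q_unital_star_algebra: "unital_star_algebra Q"
proof -
  note Qs = Q_mult Q_add Q_smult Q_star Q_one Q_zero C_add C_mult C_smult C_star C_const
    cls_in_Q C_carrier
  have "abelian_group Q"
  proof (rule abelian_groupI)
    fix x assume "x \<in> carrier Q"
    then obtain X where X: "X \<in> C" "x = cls X" by (rule carrier_Q_E)
    have "(-1) \<odot> X i \<oplus> X i = \<zero>" for i using X C_carrier smult_minus_one l_neg by metis
    then show "\<exists>y\<in>carrier Q. y \<oplus>\<^bsub>Q\<^esub> x = \<zero>\<^bsub>Q\<^esub>"
      using X by (intro bexI[of _ "cls (\<lambda>i. (-1) \<odot> X i)"]) (auto simp: Qs)
  qed (auto elim!: carrier_Q_E simp: Qs a_assoc a_comm a_lcomm)
  moreover have "monoid Q"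
    by (rule monoidI) (auto elim!: carrier_Q_E simp: Qs m_assoc)
  ultimately have "ring Q"
    by (rule ringI) (auto elim!: carrier_Q_E simp: Qs l_distr r_distr)
  then show ?thesis
    by (intro unital_star_algebra.intro unital_star_algebra_axioms.intro)
       (auto elim!: carrier_Q_E simp: Qs smult_l_distr smult_r_distr smult_smult smult_one
         smult_mult_left smult_mult_right star_star star_add star_smult star_mult)
qed

lemma Q_seminorm: "cstar_seminorm Q (cnorm Q)"
proof -
  have "lim (\<lambda>i. p (X i)) \<ge> 0" if X: "X \<in> C" for X
    using C_norm_lim[OF X] p_nonneg[OF C_carrier[OF X]] LIMSEQ_le_const by blast
  moreover have "lim (\<lambda>i. p (c \<odot> X i)) = cmod c * lim (\<lambda>i. p (X i))" if X: "X \<in> C" for X c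
    using C_norm_lim[OF X] C_carrier[OF X] by (intro limI) (auto simp: p_smult intro!: tendsto_mult)
  moreover have "lim (\<lambda>i. p (X i \<oplus> Y i)) \<le> lim (\<lambda>i. p (X i)) + lim (\<lambda>i. p (Y i))"
    if X: "X \<in> C" and Y: "Y \<in> C" for X Y
    using C_carrier[OF X] C_carrier[OF Y]
    by (intro LIMSEQ_le[OF C_norm_lim[OF C_add[OF X Y]] tendsto_add[OF C_norm_lim[OF X] C_norm_lim[OF Y]]])
       (auto intro: p_add)
  moreover have "lim (\<lambda>i. p (X i \<otimes> Y i)) \<le> lim (\<lambda>i. p (X i)) * lim (\<lambda>i. p (Y i))"
    if X: "X \<in> C" and Y: "Y \<in> C" for X Y
    using C_carrier[OF X] C_carrier[OF Y]
    by (intro LIMSEQ_le[OF C_norm_lim[OF C_mult[OF X Y]] tendsto_mult[OF C_norm_lim[OF X] C_norm_lim[OF Y]]])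
       (auto intro: p_mult)
  moreover have "lim (\<lambda>i. p (star A (X i) \<otimes> X i)) = (lim (\<lambda>i. p (X i)))\<^sup>2" if X: "X \<in> C" for X
    using C_norm_lim[OF X] C_carrier[OF X] by (intro limI) (auto simp: p_cstar intro!: tendsto_power)
  ultimately show ?thesis unfolding cstar_seminorm_def
    by (auto elim!: carrier_Q_E simp: Q_mult Q_add Q_smult Q_star Q_norm C_add C_mult C_smult C_star)
qed

lemma Q_diff: assumes X: "X \<in> C" and Y: "Y \<in> C" shows "cls X \<ominus>\<^bsub>Q\<^esub> cls Y = cls (\<lambda>i. X i \<ominus> Y i)"
proof -
  interpret Q: unital_star_algebra Q by (rule Q_unital_star_algebra)
  have "cls X \<ominus>\<^bsub>Q\<^esub> cls Y = cls X \<oplus>\<^bsub>Q\<^esub> (-1) \<odot>\<^bsub>Q\<^esub> cls Y"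
    using Q.smult_minus_one cls_in_Q Y by (simp add: a_minus_def)
  also have "\<dots> = cls (\<lambda>i. X i \<oplus> (-1) \<odot> Y i)" using X Y by (simp add: Q_add Q_smult C_smult)
  finally show ?thesis using C_carrier[OF Y] by (simp add: a_minus_def smult_minus_one)
qed

theorem completion_cstar: "unital_cstar_algebra Q"
proof (intro unital_cstar_algebra.intro unital_cstar_algebra_axioms.intro)
  show "unital_star_algebra Q" by (rule Q_unital_star_algebra)
  show "cstar_seminorm Q (cnorm Q)" by (rule Q_seminorm)
  fix x assume "x \<in> carrier Q" "cnorm Q x = 0"
  then obtain X where X: "X \<in> C" "x = cls X" "lim (\<lambda>i. p (X i)) = 0"
    using Q_norm by (metis carrier_Q_E)
  have "X i \<ominus> \<zero> = X i" for i using C_carrier[OF X(1)] by algebra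
  then have "(X, \<lambda>i. \<zero>) \<in> N" using X C_norm_lim[OF X(1)] by (simp add: N_iff C_const)
  then show "x = \<zero>\<^bsub>Q\<^esub>" using X by (simp add: Q_zero cls_eq_iff C_const)
next
  fix a assume "a \<in> cauchy_seqs Q (cnorm Q)"
  then have aQ: "\<And>k. a k \<in> carrier Q" and
    aC: "\<And>e. e > 0 \<Longrightarrow> \<exists>K. \<forall>i\<ge>K. \<forall>j\<ge>K. cnorm Q (a i \<ominus>\<^bsub>Q\<^esub> a j) < e"
    by (auto simp: cauchy_seqs_def)
  have "\<forall>k. \<exists>X. X \<in> C \<and> a k = cls X" using aQ by (auto simp: carrier_Q)
  then have "\<exists>X. \<forall>k. X k \<in> C \<and> a k = cls (X k)" by (rule choice)
  then obtain X where X: "\<And>k. X k \<in> C" "\<And>k. a k = cls (X k)" by blast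
  have Xc: "X k i \<in> carrier A" for k i using X C_carrier by blast
  have "\<exists>M. \<forall>i\<ge>M. \<forall>j\<ge>M. p (X k i \<ominus> X k j) < inverse (real (Suc k))" for k
    using C_D[OF X(1)] by simp
  then obtain M where M: "\<And>k i j. i \<ge> M k \<Longrightarrow> j \<ge> M k \<Longrightarrow> p (X k i \<ominus> X k j) < inverse (real (Suc k))"
    by metis
  define Y where "Y k = X k (M k)" for k
  have Yc: "Y k \<in> carrier A" for k using Xc by (simp add: Y_def)
  have norm_lim: "(\<lambda>i. p (X k i \<ominus> X l i)) \<longlonglongrightarrow> cnorm Q (a k \<ominus>\<^bsub>Q\<^esub> a l)" for k l
    using C_norm_lim[OF C_diff[OF X(1) X(1)]] by (simp add: X Q_diff Q_norm C_diff)
  have dYY: "p (Y k \<ominus> Y l) \<le> inverse (real (Suc k)) + cnorm Q (a k \<ominus>\<^bsub>Q\<^esub> a l) + inverse (real (Suc l))" for k l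
  proof (rule LIMSEQ_le_const)
    show "(\<lambda>i. inverse (real (Suc k)) + p (X k i \<ominus> X l i) + inverse (real (Suc l))) \<longlonglongrightarrow>
      inverse (real (Suc k)) + cnorm Q (a k \<ominus>\<^bsub>Q\<^esub> a l) + inverse (real (Suc l))"
      by (intro tendsto_intros norm_lim)
    show "\<exists>K. \<forall>i\<ge>K. p (Y k \<ominus> Y l) \<le> inverse (real (Suc k)) + p (X k i \<ominus> X l i) + inverse (real (Suc l))"
    proof (intro exI allI impI)
      fix i assume i: "i \<ge> max (M k) (M l)"
      have "p (Y k \<ominus> Y l) \<le> p (Y k \<ominus> X k i) + (p (X k i \<ominus> X l i) + p (X l i \<ominus> Y l))"
        using p_diff_triangle[of "Y k" "X k i" "Y l"] p_diff_triangle[of "X k i" "X l i" "Y l"] Xc Yc by force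
      moreover have "p (Y k \<ominus> X k i) < inverse (real (Suc k))" using M[of k "M k" i] i by (simp add: Y_def)
      moreover have "p (X l i \<ominus> Y l) < inverse (real (Suc l))" using M[of l i "M l"] i by (simp add: Y_def)
      ultimately show "p (Y k \<ominus> Y l) \<le> inverse (real (Suc k)) + p (X k i \<ominus> X l i) + inverse (real (Suc l))" by linarith
    qed
  qed
  have inv: "\<exists>K. \<forall>k\<ge>K. inverse (real (Suc k)) < e" if "e > 0" for e
    using LIMSEQ_inverse_real_of_nat that by (auto simp: LIMSEQ_def)
  have YC: "Y \<in> C"
  proof (rule C_I[OF Yc])
    fix e :: real assume "e > 0"
    then have e3: "e/3 > 0" by simp
    obtain K1 where K1: "\<forall>i\<ge>K1. \<forall>j\<ge>K1. cnorm Q (a i \<ominus>\<^bsub>Q\<^esub> a j) < e/3" using aC[OF e3] by blast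
    obtain K2 where K2: "\<forall>k\<ge>K2. inverse (real (Suc k)) < e/3" using inv[OF e3] by blast
    have "p (Y i \<ominus> Y j) < e" if "i \<ge> max K1 K2" "j \<ge> max K1 K2" for i j
    proof -
      have "cnorm Q (a i \<ominus>\<^bsub>Q\<^esub> a j) < e/3" "inverse (real (Suc i)) < e/3" "inverse (real (Suc j)) < e/3"
        using K1 K2 that by (auto simp del: of_nat_Suc)
      then show ?thesis using dYY[of i j] by linarith
    qed
    then show "\<exists>N. \<forall>i\<ge>N. \<forall>j\<ge>N. p (Y i \<ominus> Y j) < e" by blast
  qed
  have "(\<lambda>k. cnorm Q (a k \<ominus>\<^bsub>Q\<^esub> cls Y)) \<longlonglongrightarrow> 0"
  proof (rule LIMSEQ_I)
    fix e :: real assume "e > 0"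
    then have e3: "e/3 > 0" by simp
    obtain K1 where K1: "\<forall>i\<ge>K1. \<forall>j\<ge>K1. p (Y i \<ominus> Y j) < e/3" using C_D[OF YC e3] by blast
    obtain K2 where K2: "\<forall>k\<ge>K2. inverse (real (Suc k)) < e/3" using inv[OF e3] by blast
    have "norm (cnorm Q (a k \<ominus>\<^bsub>Q\<^esub> cls Y) - 0) < e" if k: "k \<ge> max K1 K2" for k
    proof -
      have lim: "(\<lambda>i. p (X k i \<ominus> Y i)) \<longlonglongrightarrow> cnorm Q (a k \<ominus>\<^bsub>Q\<^esub> cls Y)"
        using C_norm_lim[OF C_diff[OF X(1) YC]] by (simp add: X Q_diff Q_norm C_diff YC)
      have "cnorm Q (a k \<ominus>\<^bsub>Q\<^esub> cls Y) \<le> e/3 + e/3"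
      proof (rule LIMSEQ_le_const2[OF lim], intro exI allI impI)
        fix i assume i: "i \<ge> max K1 (M k)"
        have "p (X k i \<ominus> Y i) \<le> p (X k i \<ominus> Y k) + p (Y k \<ominus> Y i)" using p_diff_triangle Xc Yc by blast
        moreover have "p (X k i \<ominus> Y k) < inverse (real (Suc k))" using M[of k i "M k"] i by (simp add: Y_def)
        moreover have "inverse (real (Suc k)) < e/3" using K2 k by simp
        moreover have "p (Y k \<ominus> Y i) < e/3" using K1 k i by simp
        ultimately show "p (X k i \<ominus> Y i) \<le> e/3 + e/3" by linarith
      qed
      moreover have "cnorm Q (a k \<ominus>\<^bsub>Q\<^esub> cls Y) \<ge> 0"
        using LIMSEQ_le_const[OF lim] p_nonneg Xc Yc by blast
      ultimately show ?thesis using \<open>e > 0\<close> by simp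
    qed
    then show "\<exists>no. \<forall>k\<ge>no. norm (cnorm Q (a k \<ominus>\<^bsub>Q\<^esub> cls Y) - 0) < e" by blast
  qed
  then show "\<exists>x\<in>carrier Q. (\<lambda>i. cnorm Q (a i \<ominus>\<^bsub>Q\<^esub> x)) \<longlonglongrightarrow> 0" using cls_in_Q[OF YC] by blast
qed

end

subsection \<open>The free unital $*$-algebra and its largest seminorm\<close>

abbreviation words :: "nat \<Rightarrow> word set" where
  "words m \<equiv> {w. fst ` set w \<subseteq> {..<m}}"

abbreviation word_star :: "word \<Rightarrow> word" where
  "word_star w \<equiv> rev (map (apsnd Not) w)"

definition dirac :: "word \<Rightarrow> word \<Rightarrow> complex" where
  "dirac v = (\<lambda>w. if w = v then 1 else 0)"

lemma free_simps:
  "carrier (free_star_algebra m) = {f. finite {w. f w \<noteq> 0} \<and> {w. f w \<noteq> 0} \<subseteq> words m}"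
  "f \<otimes>\<^bsub>free_star_algebra m\<^esub> g = (\<lambda>w. \<Sum>i\<le>length w. f (take i w) * g (drop i w))"
  "\<one>\<^bsub>free_star_algebra m\<^esub> = dirac []"
  "\<zero>\<^bsub>free_star_algebra m\<^esub> = (\<lambda>w. 0)"
  "f \<oplus>\<^bsub>free_star_algebra m\<^esub> g = (\<lambda>w. f w + g w)"
  "c \<odot>\<^bsub>free_star_algebra m\<^esub> f = (\<lambda>w. c * f w)"
  "star (free_star_algebra m) f = (\<lambda>w. cnj (f (word_star w)))"
  by (auto simp: free_star_algebra_def dirac_def)

lemma free_gen_dirac: "free_gen j = dirac [(j, False)]"
  by (simp add: free_gen_def dirac_def)

lemma word_star_star [simp]: "word_star (word_star w) = w"
  by (simp add: rev_map[symmetric] o_def apsnd_def map_prod_def case_prod_unfold)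

lemma word_star_words: "word_star w \<in> words m \<longleftrightarrow> w \<in> words m"
  by (simp add: image_image)

lemma word_star_eq: "word_star w = v \<longleftrightarrow> w = word_star v"
  by (metis word_star_star)

lemma dirac_carrier: "w \<in> words m \<Longrightarrow> dirac w \<in> carrier (free_star_algebra m)"
  by (auto simp: free_simps dirac_def)

lemma dirac_mult: "dirac v \<otimes>\<^bsub>free_star_algebra m\<^esub> dirac w = dirac (v @ w)"
proof
  fix u
  show "(dirac v \<otimes>\<^bsub>free_star_algebra m\<^esub> dirac w) u = dirac (v @ w) u"
  proof (cases "u = v @ w")
    case True
    have "(\<Sum>i\<le>length u. dirac v (take i u) * dirac w (drop i u)) =
          (\<Sum>i\<le>length u. if i = length v then 1 else 0)"
    proof (rule sum.cong[OF refl])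
      fix i assume "i \<in> {..length u}"
      moreover have "take i u = v \<longleftrightarrow> i = length v" if "i \<le> length u"
        using that True by (metis append_eq_conv_conj length_take min.absorb2)
      ultimately show "dirac v (take i u) * dirac w (drop i u) = (if i = length v then 1 else 0)"
        by (simp add: dirac_def True)
    qed
    then show ?thesis using True by (simp add: free_simps dirac_def)
  next
    case False
    have "(\<Sum>i\<le>length u. dirac v (take i u) * dirac w (drop i u)) = (\<Sum>i\<le>length u. 0)"
      using False by (intro sum.cong) (auto simp: dirac_def)
    then show ?thesis using False by (simp add: free_simps dirac_def)
  qed
qed

lemma dirac_star: "star (free_star_algebra m) (dirac w) = dirac (word_star w)"
  by (auto simp: free_simps dirac_def word_star_eq fun_eq_iff simp del: rev_map)

lemma conv_assoc:
  fixes f g h :: "word \<Rightarrow> complex"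
  shows "(\<Sum>i\<le>length w. (\<Sum>j\<le>length (take i w). f (take j (take i w)) * g (drop j (take i w))) * h (drop i w)) =
    (\<Sum>i\<le>length w. f (take i w) * (\<Sum>j\<le>length (drop i w). g (take j (drop i w)) * h (drop j (drop i w))))"
proof -
  have "(\<Sum>i\<le>length w. (\<Sum>j\<le>length (take i w). f (take j (take i w)) * g (drop j (take i w))) * h (drop i w)) =
     (\<Sum>i\<le>length w. \<Sum>j\<le>i. f (take j w) * g (take (i-j) (drop j w)) * h (drop i w))"
    by (intro sum.cong refl) (auto simp: sum_distrib_right min_def drop_take intro!: sum.cong)
  also have "\<dots> = (\<Sum>(i,j)\<in>Sigma {..length w} (\<lambda>i. {..i}). f (take j w) * g (take (i-j) (drop j w)) * h (drop i w))"
    by (subst sum.Sigma) auto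
  also have "\<dots> = (\<Sum>(j,k)\<in>Sigma {..length w} (\<lambda>j. {..length w - j}). f (take j w) * g (take k (drop j w)) * h (drop (j+k) w))"
    by (rule sum.reindex_bij_witness[where i="\<lambda>(j,k). (j+k, j)" and j="\<lambda>(i,j). (j, i-j)"]) auto
  also have "\<dots> = (\<Sum>j\<le>length w. \<Sum>k\<le>length w - j. f (take j w) * g (take k (drop j w)) * h (drop (j+k) w))"
    by (subst sum.Sigma) auto
  also have "\<dots> = (\<Sum>i\<le>length w. f (take i w) * (\<Sum>j\<le>length (drop i w). g (take j (drop i w)) * h (drop j (drop i w))))"
    by (intro sum.cong refl) (auto simp: sum_distrib_left add.commute mult.assoc intro!: sum.cong)
  finally show ?thesis .
qed

lemma conv_carrier:
  assumes "f \<in> carrier (free_star_algebra m)" "g \<in> carrier (free_star_algebra m)"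
  shows "f \<otimes>\<^bsub>free_star_algebra m\<^esub> g \<in> carrier (free_star_algebra m)"
proof -
  let ?h = "f \<otimes>\<^bsub>free_star_algebra m\<^esub> g"
  let ?S = "(\<lambda>(u, v). u @ v) ` ({w. f w \<noteq> 0} \<times> {w. g w \<noteq> 0})"
  have sub: "{w. ?h w \<noteq> 0} \<subseteq> ?S"
  proof
    fix w assume "w \<in> {w. ?h w \<noteq> 0}"
    then have "(\<Sum>i\<le>length w. f (take i w) * g (drop i w)) \<noteq> 0" by (simp only: free_simps mem_Collect_eq not_False_eq_True)
    then obtain i where "f (take i w) * g (drop i w) \<noteq> 0"
      by (rule sum.not_neutral_contains_not_neutral)
    then show "w \<in> ?S" by (intro image_eqI[of _ _ "(take i w, drop i w)"]) auto
  qed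
  moreover have "finite ?S" using assms by (auto simp: free_simps)
  moreover have "?S \<subseteq> words m" using assms by (fastforce simp: free_simps)
  ultimately show ?thesis by (auto simp: free_simps(1) intro: finite_subset)
qed

lemma free_unital_star_algebra: "unital_star_algebra (free_star_algebra m)" (is "unital_star_algebra ?F")
proof -
  have add: "f \<oplus>\<^bsub>?F\<^esub> g \<in> carrier ?F" if "f \<in> carrier ?F" "g \<in> carrier ?F" for f g
  proof -
    have "{w. f w + g w \<noteq> 0} \<subseteq> {w. f w \<noteq> 0} \<union> {w. g w \<noteq> 0}" by auto
    moreover have "{w. f w \<noteq> 0} \<union> {w. g w \<noteq> 0} \<subseteq> words m" "finite ({w. f w \<noteq> 0} \<union> {w. g w \<noteq> 0})"
      using that unfolding free_simps by blast+
    ultimately show ?thesis unfolding free_simps mem_Collect_eq by (meson finite_subset subset_trans)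
  qed
  have smult: "c \<odot>\<^bsub>?F\<^esub> f \<in> carrier ?F" if "f \<in> carrier ?F" for f c
    using that by (auto simp: free_simps intro: finite_subset[of _ "{w. f w \<noteq> 0}"])
  have ab: "abelian_group ?F"
  proof (rule abelian_groupI)
    fix x assume "x \<in> carrier ?F"
    then show "\<exists>y\<in>carrier ?F. y \<oplus>\<^bsub>?F\<^esub> x = \<zero>\<^bsub>?F\<^esub>"
      using smult[of x "-1"] by (intro bexI[of _ "(-1) \<odot>\<^bsub>?F\<^esub> x"]) (auto simp: free_simps)
  qed (use add in \<open>auto simp: free_simps add_ac\<close>)
  have mon: "Group.monoid ?F"
  proof (rule monoidI)
    fix f g h
    show "f \<otimes>\<^bsub>?F\<^esub> g \<otimes>\<^bsub>?F\<^esub> h = f \<otimes>\<^bsub>?F\<^esub> (g \<otimes>\<^bsub>?F\<^esub> h)"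
      by (rule ext) (simp only: free_simps conv_assoc)
  next
    fix f :: "word \<Rightarrow> complex"
    show "\<one>\<^bsub>?F\<^esub> \<otimes>\<^bsub>?F\<^esub> f = f"
    proof
      fix w :: word
      have "(\<Sum>i\<le>length w. dirac [] (take i w) * f (drop i w)) = (\<Sum>i\<le>length w. if i = 0 then f w else 0)"
        by (rule sum.cong) (auto simp: dirac_def)
      then show "(\<one>\<^bsub>?F\<^esub> \<otimes>\<^bsub>?F\<^esub> f) w = f w" by (simp add: free_simps)
    qed
    show "f \<otimes>\<^bsub>?F\<^esub> \<one>\<^bsub>?F\<^esub> = f"
    proof
      fix w :: word
      have "(\<Sum>i\<le>length w. f (take i w) * dirac [] (drop i w)) = (\<Sum>i\<le>length w. if i = length w then f w else 0)"
        by (rule sum.cong) (auto simp: dirac_def)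
      then show "(f \<otimes>\<^bsub>?F\<^esub> \<one>\<^bsub>?F\<^esub>) w = f w" by (simp add: free_simps)
    qed
  qed (auto intro: conv_carrier simp: free_simps(3) dirac_carrier)
  have ring: "ring ?F"
    by (rule ringI[OF ab mon]) (auto simp: free_simps ring_distribs sum.distrib)
  have star: "star ?F f \<in> carrier ?F" if "f \<in> carrier ?F" for f
  proof -
    have "{w. f (word_star w) \<noteq> 0} = word_star ` {w. f w \<noteq> 0}"
      by (auto simp: image_iff) (metis word_star_star)+
    moreover have "word_star ` {w. f w \<noteq> 0} \<subseteq> words m" using that word_star_words by (force simp: free_simps)
    ultimately show ?thesis using that by (simp add: free_simps)
  qed
  have star_mult: "star ?F (f \<otimes>\<^bsub>?F\<^esub> g) = star ?F g \<otimes>\<^bsub>?F\<^esub> star ?F f" for f g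
  proof
    fix w :: word
    have "(\<Sum>i\<le>length w. f (take i (word_star w)) * g (drop i (word_star w))) =
      (\<Sum>i\<le>length w. f (word_star (drop i w)) * g (word_star (take i w)))"
      by (rule sum.reindex_bij_witness[where i="\<lambda>i. length w - i" and j="\<lambda>i. length w - i"])
         (auto simp: take_rev drop_rev drop_map take_map)
    note arg_cong[OF this, of cnj]
    then show "star ?F (f \<otimes>\<^bsub>?F\<^esub> g) w = (star ?F g \<otimes>\<^bsub>?F\<^esub> star ?F f) w"
      by (simp only: free_simps cnj_sum complex_cnj_mult mult.commute length_rev length_map)
  qed
  show ?thesis
    by (intro unital_star_algebra.intro unital_star_algebra_axioms.intro ring smult star star_mult)
       (auto simp: free_simps(2-) algebra_simps sum_distrib_left simp del: rev_map)
qed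

lemma free_induct [consumes 1, case_names zero add]:
  assumes "f \<in> carrier (free_star_algebra m)"
    and "P (\<lambda>w. 0)"
    and "\<And>c w g. w \<in> words m \<Longrightarrow> g \<in> carrier (free_star_algebra m) \<Longrightarrow> P g \<Longrightarrow>
       P (c \<odot>\<^bsub>free_star_algebra m\<^esub> dirac w \<oplus>\<^bsub>free_star_algebra m\<^esub> g)"
  shows "P f"
proof -
  have "finite S \<Longrightarrow> S \<subseteq> words m \<Longrightarrow> {w. f w \<noteq> 0} \<subseteq> S \<Longrightarrow> P f" for S
  proof (induction S arbitrary: f rule: finite_induct)
    case empty
    then have "f = (\<lambda>w. 0)" by auto
    then show ?case using assms(2) by simp
  next
    case (insert v S)
    let ?g = "f(v := 0)"
    have sub: "{w. ?g w \<noteq> 0} \<subseteq> S" using insert.prems by auto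
    have "S \<subseteq> words m" using insert.prems(1) by (rule subset_trans[OF subset_insertI])
    then have "?g \<in> carrier (free_star_algebra m)"
      unfolding free_simps mem_Collect_eq using finite_subset[OF sub insert.hyps(1)] subset_trans[OF sub] by blast
    moreover have f: "f v \<odot>\<^bsub>free_star_algebra m\<^esub> dirac v \<oplus>\<^bsub>free_star_algebra m\<^esub> ?g = f"
      by (auto simp: free_simps dirac_def)
    moreover have "P ?g" by (rule insert.IH) (fact \<open>S \<subseteq> words m\<close> sub)+
    moreover have "v \<in> words m" using insert.prems(1) by simp
    ultimately show ?case using assms(3)[of v ?g "f v", unfolded f] by blast
  qed
  then show ?thesis using assms(1) by (auto simp: free_simps)
qed

locale bounded_relations =
  fixes m :: nat and R :: "(word \<Rightarrow> complex) set"
  assumes R_carrier: "R \<subseteq> carrier (free_star_algebra m)"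
    and R_bounded: "\<And>j. j < m \<Longrightarrow> \<exists>B. \<forall>p. cstar_seminorm (free_star_algebra m) p \<longrightarrow>
       (\<forall>r\<in>R. p r = 0) \<longrightarrow> p (free_gen j) \<le> B"
begin

abbreviation "F \<equiv> free_star_algebra m"
abbreviation "SN \<equiv> {p. cstar_seminorm F p \<and> (\<forall>r\<in>R. p r = 0)}"
abbreviation "us \<equiv> universal_seminorm m R"

sublocale F: unital_star_algebra F by (rule free_unital_star_algebra)

lemma SN_seminormed: "p \<in> SN \<Longrightarrow> seminormed_star_algebra F p"
  by (intro seminormed_star_algebra.intro seminormed_star_algebra_axioms.intro F.unital_star_algebra_axioms) auto

lemma zero_in_SN: "(\<lambda>f. 0) \<in> SN"
  by (auto simp: cstar_seminorm_def)

lemma dirac_bounded: "w \<in> words m \<Longrightarrow> \<exists>B. \<forall>p\<in>SN. p (dirac w) \<le> B"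
proof (induction w)
  case Nil
  have "p (dirac []) \<le> 1" if "p \<in> SN" for p
  proof -
    interpret seminormed_star_algebra F p by (rule SN_seminormed[OF that])
    have "(p \<one>\<^bsub>F\<^esub>)\<^sup>2 = p (star F \<one>\<^bsub>F\<^esub> \<otimes>\<^bsub>F\<^esub> \<one>\<^bsub>F\<^esub>)" by (simp add: p_cstar)
    also have "star F \<one>\<^bsub>F\<^esub> \<otimes>\<^bsub>F\<^esub> \<one>\<^bsub>F\<^esub> = \<one>\<^bsub>F\<^esub>" by (simp add: free_simps(3) dirac_star dirac_mult)
    finally have "p \<one>\<^bsub>F\<^esub> * p \<one>\<^bsub>F\<^esub> = p \<one>\<^bsub>F\<^esub> * 1" by (simp add: power2_eq_square)
    then have "p \<one>\<^bsub>F\<^esub> = 0 \<or> p \<one>\<^bsub>F\<^esub> = 1" unfolding mult_cancel_left by blast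
    then have "p \<one>\<^bsub>F\<^esub> \<le> 1" by linarith
    then show ?thesis by (simp add: free_simps(3))
  qed
  then show ?case by blast
next
  case (Cons a w)
  obtain j s where a: "a = (j, s)" by force
  have j: "j < m" and w: "w \<in> words m" using Cons.prems a by auto
  obtain B1 where B1: "\<And>p. p \<in> SN \<Longrightarrow> p (free_gen j) \<le> B1" using R_bounded[OF j] by blast
  obtain B2 where B2: "\<And>p. p \<in> SN \<Longrightarrow> p (dirac w) \<le> B2" using Cons.IH w by auto
  have "p (dirac (a # w)) \<le> B1 * B2" if p: "p \<in> SN" for p
  proof -
    interpret seminormed_star_algebra F p by (rule SN_seminormed[OF p])
    have c: "dirac [a] \<in> carrier F" "free_gen j \<in> carrier F" "dirac w \<in> carrier F"
      using j w a by (auto simp: free_gen_dirac intro!: dirac_carrier)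
    have "dirac [a] = (if s then star F (free_gen j) else free_gen j)"
      by (simp add: free_gen_dirac a dirac_star)
    then have "p (dirac [a]) = p (free_gen j)" using p_star[OF c(2)] by auto
    moreover have "p (dirac (a # w)) \<le> p (dirac [a]) * p (dirac w)"
      using p_mult[OF c(1) c(3)] by (simp add: dirac_mult)
    moreover have "p (free_gen j) * p (dirac w) \<le> B1 * B2"
      using B1[OF p] B2[OF p] p_nonneg[OF c(2)] p_nonneg[OF c(3)] by (intro mult_mono) auto
    ultimately show ?thesis by simp
  qed
  then show ?case by blast
qed

lemma free_bounded: "f \<in> carrier F \<Longrightarrow> \<exists>B. \<forall>p\<in>SN. p f \<le> B"
proof (induction rule: free_induct)
  case zero
  have "p (\<lambda>w. 0) \<le> 0" if "p \<in> SN" for p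
    using seminormed_star_algebra.p_zero[OF SN_seminormed[OF that]] by (simp add: free_simps)
  then show ?case by blast
next
  case (add c w g)
  obtain B1 where B1: "\<And>p. p \<in> SN \<Longrightarrow> p (dirac w) \<le> B1" using dirac_bounded[OF add.hyps(1)] by auto
  obtain B2 where B2: "\<And>p. p \<in> SN \<Longrightarrow> p g \<le> B2" using add.IH by auto
  have "p (c \<odot>\<^bsub>F\<^esub> dirac w \<oplus>\<^bsub>F\<^esub> g) \<le> cmod c * B1 + B2" if p: "p \<in> SN" for p
  proof -
    interpret seminormed_star_algebra F p by (rule SN_seminormed[OF p])
    have "p (c \<odot>\<^bsub>F\<^esub> dirac w \<oplus>\<^bsub>F\<^esub> g) \<le> cmod c * p (dirac w) + p g"
      using add.hyps p_add[of "c \<odot>\<^bsub>F\<^esub> dirac w" g] by (simp add: F.smult_closed p_smult dirac_carrier)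
    also have "\<dots> \<le> cmod c * B1 + B2" using B1[OF p] B2[OF p] by (intro add_mono mult_left_mono) auto
    finally show ?thesis .
  qed
  then show ?case by blast
qed

lemma us_upper: "f \<in> carrier F \<Longrightarrow> p \<in> SN \<Longrightarrow> p f \<le> us f"
  unfolding universal_seminorm_def using free_bounded[of f]
  by (intro cSUP_upper) (auto simp: bdd_above_def)

lemma us_least: "(\<And>p. p \<in> SN \<Longrightarrow> p f \<le> B) \<Longrightarrow> us f \<le> B"
  unfolding universal_seminorm_def using zero_in_SN by (intro cSUP_least) auto

lemma us_rel: "r \<in> R \<Longrightarrow> us r = 0"
proof -
  assume r: "r \<in> R"
  then have "us r \<le> 0" by (intro us_least) auto
  moreover have "0 \<le> us r" using us_upper[OF _ zero_in_SN] r R_carrier by auto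
  ultimately show ?thesis by simp
qed

lemma us_seminorm: "cstar_seminorm F us"
proof -
  have nn: "0 \<le> us f" if "f \<in> carrier F" for f using us_upper[OF that zero_in_SN] .
  have smult_le: "us (c \<odot>\<^bsub>F\<^esub> f) \<le> cmod c * us f" if f: "f \<in> carrier F" for f c
  proof (rule us_least)
    fix p assume p: "p \<in> SN"
    show "p (c \<odot>\<^bsub>F\<^esub> f) \<le> cmod c * us f"
      using us_upper[OF f p] by (simp add: seminormed_star_algebra.p_smult[OF SN_seminormed[OF p] f] mult_left_mono)
  qed
  have smult: "us (c \<odot>\<^bsub>F\<^esub> f) = cmod c * us f" if f: "f \<in> carrier F" for f c
  proof (cases "c = 0")
    case True then show ?thesis using smult_le[OF f, of c] nn[OF F.smult_closed[OF f]] by (auto intro: antisym)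
  next
    case False
    have "us f = us (inverse c \<odot>\<^bsub>F\<^esub> (c \<odot>\<^bsub>F\<^esub> f))" using f False by (simp add: F.smult_smult F.smult_one)
    also have "\<dots> \<le> inverse (cmod c) * us (c \<odot>\<^bsub>F\<^esub> f)"
      using smult_le[OF F.smult_closed[OF f], of "inverse c" c] by (simp add: norm_inverse)
    finally have "cmod c * us f \<le> us (c \<odot>\<^bsub>F\<^esub> f)" using False by (simp add: field_simps)
    then show ?thesis using smult_le[OF f, of c] by simp
  qed
  have add: "us (f \<oplus>\<^bsub>F\<^esub> g) \<le> us f + us g" if f: "f \<in> carrier F" "g \<in> carrier F" for f g
  proof (rule us_least)
    fix p assume p: "p \<in> SN"
    show "p (f \<oplus>\<^bsub>F\<^esub> g) \<le> us f + us g"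
      using seminormed_star_algebra.p_add[OF SN_seminormed[OF p] f] us_upper[OF f(1) p] us_upper[OF f(2) p] by linarith
  qed
  have mult: "us (f \<otimes>\<^bsub>F\<^esub> g) \<le> us f * us g" if f: "f \<in> carrier F" "g \<in> carrier F" for f g
  proof (rule us_least)
    fix p assume p: "p \<in> SN"
    have "p f * p g \<le> us f * us g"
      using us_upper[OF f(1) p] us_upper[OF f(2) p] nn[OF f(1)] seminormed_star_algebra.p_nonneg[OF SN_seminormed[OF p] f(2)]
      by (intro mult_mono) auto
    then show "p (f \<otimes>\<^bsub>F\<^esub> g) \<le> us f * us g"
      using seminormed_star_algebra.p_mult[OF SN_seminormed[OF p] f] by linarith
  qed
  have cstar: "us (star F f \<otimes>\<^bsub>F\<^esub> f) = (us f)\<^sup>2" if f: "f \<in> carrier F" for f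
  proof (rule antisym)
    have sf: "star F f \<otimes>\<^bsub>F\<^esub> f \<in> carrier F" using f F.star_closed by simp
    show "us (star F f \<otimes>\<^bsub>F\<^esub> f) \<le> (us f)\<^sup>2"
    proof (rule us_least)
      fix p assume p: "p \<in> SN"
      show "p (star F f \<otimes>\<^bsub>F\<^esub> f) \<le> (us f)\<^sup>2"
        using seminormed_star_algebra.p_cstar[OF SN_seminormed[OF p] f] us_upper[OF f p]
          seminormed_star_algebra.p_nonneg[OF SN_seminormed[OF p] f] by (simp add: power_mono)
    qed
    have "us f \<le> sqrt (us (star F f \<otimes>\<^bsub>F\<^esub> f))"
    proof (rule us_least)
      fix p assume p: "p \<in> SN"
      show "p f \<le> sqrt (us (star F f \<otimes>\<^bsub>F\<^esub> f))"
        using seminormed_star_algebra.p_cstar[OF SN_seminormed[OF p] f] us_upper[OF sf p]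
        by (intro real_le_rsqrt) simp
    qed
    then have "(us f)\<^sup>2 \<le> (sqrt (us (star F f \<otimes>\<^bsub>F\<^esub> f)))\<^sup>2" using nn[OF f] by (intro power_mono)
    then show "(us f)\<^sup>2 \<le> us (star F f \<otimes>\<^bsub>F\<^esub> f)" using nn[OF sf] by simp
  qed
  show ?thesis unfolding cstar_seminorm_def by (intro conjI ballI allI nn smult add mult cstar)
qed

sublocale F: seminormed_star_algebra F us
  by (intro seminormed_star_algebra.intro seminormed_star_algebra_axioms.intro F.unital_star_algebra_axioms us_seminorm)

theorem universal_cstar_algebra: "unital_cstar_algebra (universal_cstar m R)"
  unfolding universal_cstar_def by (rule F.completion_cstar)

end

subsection \<open>The universal property\<close>

context unital_star_algebra
begin

lemma diff_eq_zero_iff: "x \<in> carrier A \<Longrightarrow> y \<in> carrier A \<Longrightarrow> x \<ominus> y = \<zero> \<longleftrightarrow> x = y"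
  by (metis a_minus_def minus_equality minus_minus r_neg a_inv_closed)

definition eval_word :: "(nat \<Rightarrow> 'a) \<Rightarrow> word \<Rightarrow> 'a" where
  "eval_word b w = foldr (\<lambda>(j, s) a. (if s then star A (b j) else b j) \<otimes> a) w \<one>"

definition eval_free :: "(nat \<Rightarrow> 'a) \<Rightarrow> (word \<Rightarrow> complex) \<Rightarrow> 'a" where
  "eval_free b f = finsum A (\<lambda>w. f w \<odot> eval_word b w) {w. f w \<noteq> 0}"

lemma star_one: "star A \<one> = \<one>"
proof -
  have "star A (star A \<one> \<otimes> \<one>) = star A \<one> \<otimes> star A (star A \<one>)"
    by (rule star_mult) (auto intro: star_closed)
  then show ?thesis by (simp add: star_closed star_star)
qed

lemma smult_r_zero: "c \<odot> \<zero> = \<zero>"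
  using smult_smult[of \<zero> c 0] smult_zero[of \<zero>] by simp

context
  fixes m :: nat and b :: "nat \<Rightarrow> 'a"
  assumes b: "\<And>j. j < m \<Longrightarrow> b j \<in> carrier A"
begin

abbreviation (input) "F \<equiv> free_star_algebra m"

lemma eval_word_closed: "w \<in> words m \<Longrightarrow> eval_word b w \<in> carrier A"
  unfolding eval_word_def by (induction w) (auto simp: star_closed b)

lemma eval_word_append: "v \<in> words m \<Longrightarrow> w \<in> words m \<Longrightarrow> eval_word b (v @ w) = eval_word b v \<otimes> eval_word b w"
proof (induction v)
  case Nil then show ?case using eval_word_closed[of w] by (simp add: eval_word_def)
next
  case (Cons a v)
  obtain j s where a: "a = (j, s)" by force
  have "v \<in> words m" "j < m" using Cons.prems a by auto
  then show ?case using Cons.IH Cons.prems(2) eval_word_closed[of v] eval_word_closed[of w]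
    by (simp add: eval_word_def a m_assoc star_closed b)
qed

lemma eval_word_star: "w \<in> words m \<Longrightarrow> eval_word b (word_star w) = star A (eval_word b w)"
proof (induction w)
  case Nil then show ?case by (simp add: eval_word_def star_one)
next
  case (Cons a w)
  obtain j s where a: "a = (j, s)" by force
  have w: "w \<in> words m" "j < m" using Cons.prems a by auto
  then have aw: "[(j, \<not> s)] \<in> words m" "word_star w \<in> words m" using word_star_words[of w m] by auto
  have "word_star (a # w) = word_star w @ [(j, \<not> s)]" by (simp add: a)
  then have "eval_word b (word_star (a # w)) = star A (eval_word b w) \<otimes> eval_word b [(j, \<not> s)]"
    using eval_word_append[OF aw(2) aw(1)] Cons.IH w by simp
  also have "eval_word b [(j, \<not> s)] = star A (if s then star A (b j) else b j)"
    using w b[of j] by (simp add: eval_word_def star_closed star_star)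
  also have "star A (eval_word b w) \<otimes> \<dots> = star A ((if s then star A (b j) else b j) \<otimes> eval_word b w)"
    using w b[of j] eval_word_closed[of w] by (intro star_mult[symmetric]) (auto simp: star_closed)
  finally show ?case by (simp add: eval_word_def a)
qed

lemma eval_free_superset:
  assumes "finite S" "S \<subseteq> words m" "{w. f w \<noteq> 0} \<subseteq> S"
  shows "eval_free b f = finsum A (\<lambda>w. f w \<odot> eval_word b w) S"
  unfolding eval_free_def using assms
  by (intro add.finprod_mono_neutral_cong_left) (auto simp: smult_zero smult_closed eval_word_closed subset_eq)

lemma eval_free_closed: "f \<in> carrier F \<Longrightarrow> eval_free b f \<in> carrier A"
  unfolding eval_free_def by (intro finsum_closed) (auto simp: free_simps intro!: smult_closed eval_word_closed)

lemma eval_free_add: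
  assumes f: "f \<in> carrier F" and g: "g \<in> carrier F"
  shows "eval_free b (f \<oplus>\<^bsub>F\<^esub> g) = eval_free b f \<oplus> eval_free b g"
proof -
  let ?S = "{w. f w \<noteq> 0} \<union> {w. g w \<noteq> 0}"
  have S: "finite ?S" "?S \<subseteq> words m" using f g by (auto simp: free_simps)
  have c: "eval_word b w \<in> carrier A" if "w \<in> ?S" for w using that S eval_word_closed by blast
  have "eval_free b (f \<oplus>\<^bsub>F\<^esub> g) = finsum A (\<lambda>w. (f w + g w) \<odot> eval_word b w) ?S"
    unfolding free_simps by (rule eval_free_superset[OF S]) auto
  also have "\<dots> = finsum A (\<lambda>w. f w \<odot> eval_word b w \<oplus> g w \<odot> eval_word b w) ?S"
    using c by (intro finsum_cong') (auto simp: smult_l_distr smult_closed)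
  also have "\<dots> = finsum A (\<lambda>w. f w \<odot> eval_word b w) ?S \<oplus> finsum A (\<lambda>w. g w \<odot> eval_word b w) ?S"
    using c by (intro finsum_addf) (auto intro!: smult_closed)
  also have "\<dots> = eval_free b f \<oplus> eval_free b g"
    using eval_free_superset[OF S, of f] eval_free_superset[OF S, of g] by auto
  finally show ?thesis .
qed

lemma eval_free_dirac: "w \<in> words m \<Longrightarrow> eval_free b (dirac w) = eval_word b w"
  using eval_free_superset[of "{w}" "dirac w"] eval_word_closed[of w]
  by (auto simp: dirac_def smult_one)

lemma eval_free_smult_dirac:
  assumes w: "w \<in> words m"
  shows "eval_free b (c \<odot>\<^bsub>F\<^esub> dirac w) = c \<odot> eval_word b w"
proof -
  have sub: "{v. c * dirac w v \<noteq> 0} \<subseteq> {w}" by (auto simp: dirac_def split: if_splits)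
  have "eval_free b (\<lambda>v. c * dirac w v) = finsum A (\<lambda>v. (c * dirac w v) \<odot> eval_word b v) {w}"
    by (rule eval_free_superset[OF _ _ sub]) (use w in simp_all)
  also have "\<dots> = c \<odot> eval_word b w"
    using eval_word_closed[OF w] by (simp add: smult_closed dirac_def)
  finally show ?thesis by (simp only: free_simps(6))
qed

lemma eval_free_zero: "eval_free b (\<lambda>w. 0) = \<zero>"
  by (simp add: eval_free_def)

interpretation F: unital_star_algebra F by (rule free_unital_star_algebra)

lemma eval_free_smult: "f \<in> carrier F \<Longrightarrow> eval_free b (c \<odot>\<^bsub>F\<^esub> f) = c \<odot> eval_free b f"
proof (induction rule: free_induct)
  case zero then show ?case by (simp add: eval_free_zero free_simps(6) smult_r_zero)
next
  case (add d w g)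
  have w: "dirac w \<in> carrier F" using add.hyps(1) by (rule dirac_carrier)
  have "eval_free b (c \<odot>\<^bsub>F\<^esub> (d \<odot>\<^bsub>F\<^esub> dirac w \<oplus>\<^bsub>F\<^esub> g)) = eval_free b ((c * d) \<odot>\<^bsub>F\<^esub> dirac w \<oplus>\<^bsub>F\<^esub> c \<odot>\<^bsub>F\<^esub> g)"
    using w add.hyps by (simp add: F.smult_r_distr F.smult_closed F.smult_smult)
  then show ?case using w add.hyps(2) add.IH eval_word_closed[OF add.hyps(1)]
    by (simp add: eval_free_add F.smult_closed eval_free_smult_dirac[OF add.hyps(1)] smult_r_distr smult_closed smult_smult eval_free_closed)
qed

lemma eval_free_dirac_mult: "f \<in> carrier F \<Longrightarrow> v \<in> words m \<Longrightarrow>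
  eval_free b (dirac v \<otimes>\<^bsub>F\<^esub> f) = eval_word b v \<otimes> eval_free b f"
proof (induction rule: free_induct)
  case zero
  have "dirac v \<otimes>\<^bsub>F\<^esub> (\<lambda>w. 0) = (\<lambda>w. 0)" by (simp add: free_simps)
  then show ?case using eval_word_closed[OF zero] by (simp add: eval_free_zero)
next
  case (add d w g)
  have vw: "v @ w \<in> words m" using add.hyps(1) add.prems by auto
  have w: "dirac w \<in> carrier F" "dirac v \<in> carrier F" "dirac (v @ w) \<in> carrier F"
    using add.hyps(1) add.prems dirac_carrier[OF vw] by (auto intro: dirac_carrier)
  have "dirac v \<otimes>\<^bsub>F\<^esub> (d \<odot>\<^bsub>F\<^esub> dirac w \<oplus>\<^bsub>F\<^esub> g) = d \<odot>\<^bsub>F\<^esub> dirac (v @ w) \<oplus>\<^bsub>F\<^esub> dirac v \<otimes>\<^bsub>F\<^esub> g"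
    using w add.hyps(2) by (simp add: F.r_distr F.smult_closed F.smult_mult_right dirac_mult)
  then show ?case using w add.hyps(2) add.IH[OF add.prems] eval_word_closed[OF add.hyps(1)] eval_word_closed[OF add.prems]
    by (simp add: eval_free_add F.smult_closed eval_free_smult_dirac[OF add.hyps(1)]
      eval_free_smult_dirac[OF vw] eval_word_append[OF add.prems add.hyps(1)] r_distr smult_closed smult_mult_right eval_free_closed)
qed

lemma eval_free_mult: "f \<in> carrier F \<Longrightarrow> g \<in> carrier F \<Longrightarrow>
  eval_free b (f \<otimes>\<^bsub>F\<^esub> g) = eval_free b f \<otimes> eval_free b g"
proof (induction rule: free_induct)
  case zero
  have "(\<lambda>w. 0) \<otimes>\<^bsub>F\<^esub> g = (\<lambda>w. 0)" by (simp add: free_simps)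
  then show ?case using eval_free_closed[OF zero] by (simp add: eval_free_zero)
next
  case (add d w f)
  have w: "dirac w \<in> carrier F" using add.hyps(1) by (rule dirac_carrier)
  have "(d \<odot>\<^bsub>F\<^esub> dirac w \<oplus>\<^bsub>F\<^esub> f) \<otimes>\<^bsub>F\<^esub> g = d \<odot>\<^bsub>F\<^esub> (dirac w \<otimes>\<^bsub>F\<^esub> g) \<oplus>\<^bsub>F\<^esub> f \<otimes>\<^bsub>F\<^esub> g"
    using w add.hyps(2) add.prems by (simp add: F.l_distr F.smult_closed F.smult_mult_left)
  then show ?case using w add.hyps(2) add.prems add.IH[OF add.prems] eval_word_closed[OF add.hyps(1)]
    by (simp add: eval_free_add F.smult_closed eval_free_smult eval_free_smult_dirac[OF add.hyps(1)] 
      eval_free_dirac_mult[OF _ add.hyps(1)] l_distr smult_closed smult_mult_left eval_free_closed)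
qed

lemma eval_free_star: "f \<in> carrier F \<Longrightarrow> eval_free b (star F f) = star A (eval_free b f)"
proof (induction rule: free_induct)
  case zero
  have "star A \<zero> = \<zero>" using star_smult[of \<zero> 0] smult_zero[of \<zero>] smult_zero[of "star A \<zero>"] by (simp add: star_closed)
  then show ?case by (simp add: free_simps(7) eval_free_zero)
next
  case (add d w g)
  have w: "dirac w \<in> carrier F" "word_star w \<in> words m" using add.hyps(1) word_star_words[of w m] dirac_carrier by auto
  have "star F (d \<odot>\<^bsub>F\<^esub> dirac w \<oplus>\<^bsub>F\<^esub> g) = cnj d \<odot>\<^bsub>F\<^esub> dirac (word_star w) \<oplus>\<^bsub>F\<^esub> star F g"
    using w add.hyps(2) by (simp add: F.star_add F.smult_closed F.star_smult dirac_star)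
  then show ?case using w(1) dirac_carrier[OF w(2)] add.hyps(2) add.IH eval_word_closed[OF add.hyps(1)]
    by (simp add: eval_free_add F.smult_closed F.star_closed eval_free_smult_dirac[OF w(2)] 
      eval_free_smult_dirac[OF add.hyps(1)] eval_word_star[OF add.hyps(1)] star_add star_smult smult_closed eval_free_closed)
qed

lemma eval_free_hom: "eval_free b \<in> unital_star_hom F A"
proof -
  have "eval_free b \<one>\<^bsub>F\<^esub> = \<one>" using eval_free_dirac[of "[]"] by (simp add: free_simps eval_word_def)
  then show ?thesis unfolding unital_star_hom_def star_hom_def
    using eval_free_closed eval_free_add eval_free_smult eval_free_mult eval_free_star by simp
qed

lemma eval_free_gen: "j < m \<Longrightarrow> eval_free b (free_gen j) = b j"
  using eval_free_dirac[of "[(j, False)]"] b by (simp add: free_gen_dirac eval_word_def)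

end

end

lemma star_homD:
  assumes "h \<in> star_hom A B"
  shows "x \<in> carrier A \<Longrightarrow> h x \<in> carrier B"
    and "x \<in> carrier A \<Longrightarrow> y \<in> carrier A \<Longrightarrow> h (x \<oplus>\<^bsub>A\<^esub> y) = h x \<oplus>\<^bsub>B\<^esub> h y"
    and "x \<in> carrier A \<Longrightarrow> h (c \<odot>\<^bsub>A\<^esub> x) = c \<odot>\<^bsub>B\<^esub> h x"
    and "x \<in> carrier A \<Longrightarrow> y \<in> carrier A \<Longrightarrow> h (x \<otimes>\<^bsub>A\<^esub> y) = h x \<otimes>\<^bsub>B\<^esub> h y"
    and "x \<in> carrier A \<Longrightarrow> h (star A x) = star B (h x)"
  using assms unfolding star_hom_def by auto

lemma star_hom_diff:
  assumes A: "unital_star_algebra A" and B: "unital_star_algebra B" and h: "h \<in> star_hom A B"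
    and x: "x \<in> carrier A" "y \<in> carrier A"
  shows "h (x \<ominus>\<^bsub>A\<^esub> y) = h x \<ominus>\<^bsub>B\<^esub> h y"
proof -
  interpret A: unital_star_algebra A by fact
  interpret B: unital_star_algebra B by fact
  show ?thesis using x star_homD[OF h]
    by (simp add: a_minus_def A.smult_minus_one B.smult_minus_one A.smult_closed)
qed

context bounded_relations
begin

abbreviation "const_cls f \<equiv> null_rel F us `` {\<lambda>i. f}"

theorem universal_property:
  assumes B: "unital_cstar_algebra B" and h: "h \<in> unital_star_hom F B"
    and hR: "\<And>r. r \<in> R \<Longrightarrow> h r = \<zero>\<^bsub>B\<^esub>"
  shows "\<exists>\<phi>\<in>unital_star_hom (universal_cstar m R) B. \<forall>f\<in>carrier F. \<phi> (const_cls f) = h f"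
proof -
  interpret B: unital_cstar_algebra B by fact
  interpret B: seminormed_star_algebra B "cnorm B"
    by (intro seminormed_star_algebra.intro seminormed_star_algebra_axioms.intro
        B.unital_star_algebra_axioms B.cstar_seminorm)
  have hom: "h \<in> star_hom F B" and h1: "h \<one>\<^bsub>F\<^esub> = \<one>\<^bsub>B\<^esub>" using h by (auto simp: unital_star_hom_def)
  note hD = star_homD[OF hom]
  have "(\<lambda>f. cnorm B (h f)) \<in> SN"
    unfolding cstar_seminorm_def mem_Collect_eq
    by (intro conjI ballI allI) (simp_all add: hD F.smult_closed F.star_closed B.p_nonneg B.p_smult B.p_add B.p_mult B.p_cstar hR)
  from us_upper[OF _ this] have bound: "cnorm B (h f) \<le> us f" if "f \<in> carrier F" for f using that .
  have hdiff: "h (f \<ominus>\<^bsub>F\<^esub> g) = h f \<ominus>\<^bsub>B\<^esub> h g" if "f \<in> carrier F" "g \<in> carrier F" for f g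
    by (rule star_hom_diff[OF F.unital_star_algebra_axioms B.unital_star_algebra_axioms hom that])
  have dbound: "cnorm B (h f \<ominus>\<^bsub>B\<^esub> h g) \<le> us (f \<ominus>\<^bsub>F\<^esub> g)" if "f \<in> carrier F" "g \<in> carrier F" for f g
    using bound[of "f \<ominus>\<^bsub>F\<^esub> g"] that by (simp add: hdiff)
  have hC: "(\<lambda>i. h (X i)) \<in> B.C" if X: "X \<in> F.C" for X
  proof (rule B.C_I)
    show "h (X i) \<in> carrier B" for i by (rule hD(1)) (rule F.C_carrier[OF X])
    fix e :: real assume "e > 0"
    then obtain K where K: "\<forall>i\<ge>K. \<forall>j\<ge>K. us (X i \<ominus>\<^bsub>F\<^esub> X j) < e" using F.C_D[OF X] by blast
    have "cnorm B (h (X i) \<ominus>\<^bsub>B\<^esub> h (X j)) < e" if "i \<ge> K" "j \<ge> K" for i j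
      by (rule le_less_trans[OF dbound[OF F.C_carrier[OF X] F.C_carrier[OF X]]]) (use K that in simp)
    then show "\<exists>N. \<forall>i\<ge>N. \<forall>j\<ge>N. cnorm B (h (X i) \<ominus>\<^bsub>B\<^esub> h (X j)) < e" by blast
  qed
  have hN: "(\<lambda>i. h (X i), \<lambda>i. h (Y i)) \<in> B.N" if XY: "(X, Y) \<in> F.N" for X Y
  proof -
    have X: "X \<in> F.C" "Y \<in> F.C" "(\<lambda>i. us (X i \<ominus>\<^bsub>F\<^esub> Y i)) \<longlonglongrightarrow> 0" using XY by (auto simp: F.N_iff)
    have "(\<lambda>i. cnorm B (h (X i) \<ominus>\<^bsub>B\<^esub> h (Y i))) \<longlonglongrightarrow> 0"
      by (rule F.squeeze0[OF X(3)])
         (intro B.p_nonneg B.minus_closed hD(1) dbound F.C_carrier[OF X(1)] F.C_carrier[OF X(2)])+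
    then show ?thesis using X hC by (simp add: B.N_iff)
  qed
  define \<phi> where "\<phi> a = (SOME b. b \<in> carrier B \<and> (\<exists>X\<in>F.C. a = F.cls X \<and> (\<lambda>i. h (X i), \<lambda>i. b) \<in> B.N))" for a
  have uniq: "x = y" if "x \<in> carrier B" "y \<in> carrier B" "(\<lambda>i. x, \<lambda>i. y) \<in> B.N" for x y
  proof -
    have "cnorm B (x \<ominus>\<^bsub>B\<^esub> y) = 0" using that(3) by (simp add: B.N_iff LIMSEQ_const_iff)
    then have "x \<ominus>\<^bsub>B\<^esub> y = \<zero>\<^bsub>B\<^esub>" using that B.cnorm_eq_0 by simp
    then show ?thesis using that B.diff_eq_zero_iff by blast
  qed
  have Nsym: "(Y, X) \<in> B.N" if "(X, Y) \<in> B.N" for X Y using B.equiv_N that by (meson equiv_def symD)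
  have Ntrans: "(X, Z) \<in> B.N" if "(X, Y) \<in> B.N" "(Y, Z) \<in> B.N" for X Y Z
    using B.equiv_N that by (meson equiv_def transD)
  have \<phi>: "\<phi> (F.cls X) = b" if X: "X \<in> F.C" and b: "b \<in> carrier B" "(\<lambda>i. h (X i), \<lambda>i. b) \<in> B.N" for X b
    unfolding \<phi>_def
  proof (rule some_equality)
    show "b \<in> carrier B \<and> (\<exists>X'\<in>F.C. F.cls X = F.cls X' \<and> (\<lambda>i. h (X' i), \<lambda>i. b) \<in> B.N)"
      using that by blast
    fix b' assume "b' \<in> carrier B \<and> (\<exists>X'\<in>F.C. F.cls X = F.cls X' \<and> (\<lambda>i. h (X' i), \<lambda>i. b') \<in> B.N)"
    then obtain X' where b': "b' \<in> carrier B" "X' \<in> F.C" "F.cls X = F.cls X'" "(\<lambda>i. h (X' i), \<lambda>i. b') \<in> B.N" by blast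
    then have "(X, X') \<in> F.N" using X F.cls_eq_iff by blast
    from Ntrans[OF hN[OF this] b'(4)] have "(\<lambda>i. b', \<lambda>i. b) \<in> B.N" using Nsym Ntrans b(2) by blast
    then show "b' = b" using uniq b b' by blast
  qed
  have ex: "\<exists>b\<in>carrier B. (\<lambda>i. h (X i), \<lambda>i. b) \<in> B.N" if X: "X \<in> F.C" for X
  proof -
    obtain b where b: "b \<in> carrier B" "(\<lambda>i. cnorm B (h (X i) \<ominus>\<^bsub>B\<^esub> b)) \<longlonglongrightarrow> 0"
      using B.complete[OF hC[OF X]] by blast
    then show ?thesis using hC[OF X] B.C_const by (auto simp: B.N_iff)
  qed
  have \<phi>_lim: "\<phi> (F.cls X) \<in> carrier B" "(\<lambda>i. h (X i), \<lambda>i. \<phi> (F.cls X)) \<in> B.N" if X: "X \<in> F.C" for X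
    using ex[OF X] \<phi>[OF X] by auto
  have hX: "h (X i) \<in> carrier B" "X i \<in> carrier F" if "X \<in> F.C" for X i
    using hD F.C_carrier[OF that] by auto
  have "\<phi> \<in> star_hom F.Q B"
    unfolding star_hom_def mem_Collect_eq
  proof (intro conjI ballI allI Pi_I)
    fix a assume "a \<in> carrier F.Q"
    then obtain X where X: "X \<in> F.C" "a = F.cls X" by (rule F.carrier_Q_E)
    show "\<phi> a \<in> carrier B" using \<phi>_lim X by blast
    show "\<phi> (c \<odot>\<^bsub>F.Q\<^esub> a) = c \<odot>\<^bsub>B\<^esub> \<phi> a" for c
    proof -
      have "(\<lambda>i. h (c \<odot>\<^bsub>F\<^esub> X i), \<lambda>i. c \<odot>\<^bsub>B\<^esub> \<phi> (F.cls X)) \<in> B.N"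
        using B.N_smult[OF \<phi>_lim(2)[OF X(1)], of c] by (simp only: hD(3) hX[OF X(1)])
      then show ?thesis unfolding X(2) F.Q_smult[OF X(1)]
        by (intro \<phi> F.C_smult B.smult_closed \<phi>_lim(1) X(1))
    qed
    show "\<phi> (star F.Q a) = star B (\<phi> a)"
    proof -
      have "(\<lambda>i. h (star F (X i)), \<lambda>i. star B (\<phi> (F.cls X))) \<in> B.N"
        using B.N_star[OF \<phi>_lim(2)[OF X(1)]] by (simp only: hD(5) hX[OF X(1)])
      then show ?thesis unfolding X(2) F.Q_star[OF X(1)]
        by (intro \<phi> F.C_star B.star_closed \<phi>_lim(1) X(1))
    qed
    fix a' assume "a' \<in> carrier F.Q"
    then obtain Y where Y: "Y \<in> F.C" "a' = F.cls Y" by (rule F.carrier_Q_E)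
    show "\<phi> (a \<oplus>\<^bsub>F.Q\<^esub> a') = \<phi> a \<oplus>\<^bsub>B\<^esub> \<phi> a'"
    proof -
      have "(\<lambda>i. h (X i \<oplus>\<^bsub>F\<^esub> Y i), \<lambda>i. \<phi> (F.cls X) \<oplus>\<^bsub>B\<^esub> \<phi> (F.cls Y)) \<in> B.N"
        using B.N_add[OF \<phi>_lim(2)[OF X(1)] \<phi>_lim(2)[OF Y(1)]] by (simp only: hD(2) hX[OF X(1)] hX[OF Y(1)])
      then show ?thesis unfolding X(2) Y(2) F.Q_add[OF X(1) Y(1)]
        by (intro \<phi> F.C_add B.add.m_closed \<phi>_lim(1) X(1) Y(1))
    qed
    show "\<phi> (a \<otimes>\<^bsub>F.Q\<^esub> a') = \<phi> a \<otimes>\<^bsub>B\<^esub> \<phi> a'"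
    proof -
      have "(\<lambda>i. h (X i \<otimes>\<^bsub>F\<^esub> Y i), \<lambda>i. \<phi> (F.cls X) \<otimes>\<^bsub>B\<^esub> \<phi> (F.cls Y)) \<in> B.N"
        using B.N_mult[OF \<phi>_lim(2)[OF X(1)] \<phi>_lim(2)[OF Y(1)]] by (simp only: hD(4) hX[OF X(1)] hX[OF Y(1)])
      then show ?thesis unfolding X(2) Y(2) F.Q_mult[OF X(1) Y(1)]
        by (intro \<phi> F.C_mult B.m_closed \<phi>_lim(1) X(1) Y(1))
    qed
  qed
  moreover have \<phi>_const: "\<phi> (const_cls f) = h f" if f: "f \<in> carrier F" for f
    using f hD(1)[OF f] by (intro \<phi> F.C_const) (auto simp: B.N_iff B.C_const)
  moreover have "\<phi> \<one>\<^bsub>F.Q\<^esub> = \<one>\<^bsub>B\<^esub>" using \<phi>_const[OF F.one_closed] by (simp add: F.Q_one h1)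
  ultimately show ?thesis unfolding universal_cstar_def unital_star_hom_def by blast
qed

lemma const_cls_hom: "const_cls \<in> unital_star_hom F (universal_cstar m R)"
  unfolding unital_star_hom_def star_hom_def universal_cstar_def
  by (auto simp: F.Q_add F.Q_smult F.Q_mult F.Q_star F.Q_one F.C_const F.cls_in_Q)

lemma const_cls_rel: "r \<in> R \<Longrightarrow> const_cls r = \<zero>\<^bsub>universal_cstar m R\<^esub>"
proof -
  assume r: "r \<in> R"
  then have c: "r \<in> carrier F" using R_carrier by blast
  have "r \<ominus>\<^bsub>F\<^esub> \<zero>\<^bsub>F\<^esub> = r" using c by algebra
  then show ?thesis using c r unfolding universal_cstar_def
    by (simp add: F.Q_zero F.cls_eq_iff F.C_const F.N_iff us_rel)
qed

end

lemma torus_bounded_relations: "bounded_relations (dim_row \<Theta>) (torus_relations \<Theta>)"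
proof
  let ?F = "free_star_algebra (dim_row \<Theta>)"
  interpret F: unital_star_algebra ?F by (rule free_unital_star_algebra)
  have gen: "free_gen j \<in> carrier ?F" if "j < dim_row \<Theta>" for j
    using that by (auto simp: free_gen_dirac intro!: dirac_carrier)
  show "torus_relations \<Theta> \<subseteq> carrier ?F"
    by (auto simp: torus_relations_def Let_def gen F.star_closed F.smult_closed)
  fix j assume j: "j < dim_row \<Theta>"
  show "\<exists>B. \<forall>p. cstar_seminorm ?F p \<longrightarrow> (\<forall>r\<in>torus_relations \<Theta>. p r = 0) \<longrightarrow> p (free_gen j) \<le> B"
  proof (intro exI allI impI)
    fix p assume p: "cstar_seminorm ?F p" "\<forall>r\<in>torus_relations \<Theta>. p r = 0"
    interpret seminormed_star_algebra ?F p
      by (intro seminormed_star_algebra.intro seminormed_star_algebra_axioms.intro F.unital_star_algebra_axioms p)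
    let ?u = "free_gen j" and ?e = "\<one>\<^bsub>?F\<^esub>"
    let ?x = "star ?F ?u \<otimes>\<^bsub>?F\<^esub> ?u"
    have x: "?x \<in> carrier ?F" using gen[OF j] F.star_closed by simp
    have "p (?x \<ominus>\<^bsub>?F\<^esub> ?e) = 0" using p(2) j by (auto simp: torus_relations_def Let_def)
    then have "(p ?u)\<^sup>2 = p ?e" using p_diff_abs[OF x F.one_closed] p_cstar[OF gen[OF j]] by simp
    moreover have "p ?e = p ?e * p ?e"
      using p_cstar[OF F.one_closed] by (simp add: F.star_one power2_eq_square)
    then have "p ?e * p ?e = p ?e * 1" by simp
    then have "p ?e = 0 \<or> p ?e = 1" unfolding mult_cancel_left .
    ultimately have "(p ?u)\<^sup>2 \<le> 1\<^sup>2" by auto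
    then show "p ?u \<le> 1" by (rule power2_le_imp_le) simp
  qed
qed

theorem nc_torus_cstar: "unital_cstar_algebra (nc_torus \<Theta>)"
proof -
  interpret bounded_relations "dim_row \<Theta>" "torus_relations \<Theta>" by (rule torus_bounded_relations)
  show ?thesis unfolding nc_torus_def by (rule universal_cstar_algebra)
qed

definition torus_tuple :: "real mat \<Rightarrow> ('a, 'b) star_algebra_scheme \<Rightarrow> (nat \<Rightarrow> 'a) \<Rightarrow> bool" where
  "torus_tuple \<Theta> B b \<longleftrightarrow> (\<forall>j<dim_row \<Theta>. b j \<in> carrier B \<and>
       star B (b j) \<otimes>\<^bsub>B\<^esub> b j = \<one>\<^bsub>B\<^esub> \<and> b j \<otimes>\<^bsub>B\<^esub> star B (b j) = \<one>\<^bsub>B\<^esub>) \<and>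
     (\<forall>j<dim_row \<Theta>. \<forall>k<dim_row \<Theta>.
       b k \<otimes>\<^bsub>B\<^esub> b j = exp (2 * pi * \<i> * \<Theta> $$ (j, k)) \<odot>\<^bsub>B\<^esub> (b j \<otimes>\<^bsub>B\<^esub> b k))"

lemma torus_tuple_cong:
  "(\<And>j. j < dim_row \<Theta> \<Longrightarrow> b j = c j) \<Longrightarrow> torus_tuple \<Theta> B b \<longleftrightarrow> torus_tuple \<Theta> B c"
  unfolding torus_tuple_def by simp

lemma hom_torus_relations_iff:
  assumes B: "unital_star_algebra B" and h: "h \<in> unital_star_hom (free_star_algebra (dim_row \<Theta>)) B"
  shows "torus_tuple \<Theta> B (\<lambda>j. h (free_gen j)) \<longleftrightarrow> (\<forall>r\<in>torus_relations \<Theta>. h r = \<zero>\<^bsub>B\<^esub>)"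
proof -
  let ?F = "free_star_algebra (dim_row \<Theta>)"
  interpret F: unital_star_algebra ?F by (rule free_unital_star_algebra)
  interpret B: unital_star_algebra B by fact
  have hom: "h \<in> star_hom ?F B" and h1: "h \<one>\<^bsub>?F\<^esub> = \<one>\<^bsub>B\<^esub>" using h by (auto simp: unital_star_hom_def)
  note hD = star_homD[OF hom] and hdiff = star_hom_diff[OF F.unital_star_algebra_axioms B hom]
  have gen: "free_gen j \<in> carrier ?F" if "j < dim_row \<Theta>" for j
    using that by (auto simp: free_gen_dirac intro!: dirac_carrier)
  note s = gen hD h1 hdiff F.star_closed F.smult_closed B.star_closed B.smult_closed B.diff_eq_zero_iff
  have "(\<forall>r\<in>torus_relations \<Theta>. h r = \<zero>\<^bsub>B\<^esub>) \<longleftrightarrow>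
    (\<forall>j<dim_row \<Theta>. h (star ?F (free_gen j) \<otimes>\<^bsub>?F\<^esub> free_gen j \<ominus>\<^bsub>?F\<^esub> \<one>\<^bsub>?F\<^esub>) = \<zero>\<^bsub>B\<^esub>) \<and>
    (\<forall>j<dim_row \<Theta>. h (free_gen j \<otimes>\<^bsub>?F\<^esub> star ?F (free_gen j) \<ominus>\<^bsub>?F\<^esub> \<one>\<^bsub>?F\<^esub>) = \<zero>\<^bsub>B\<^esub>) \<and>
    (\<forall>j<dim_row \<Theta>. \<forall>k<dim_row \<Theta>. h (free_gen k \<otimes>\<^bsub>?F\<^esub> free_gen j \<ominus>\<^bsub>?F\<^esub>
        exp (2 * pi * \<i> * \<Theta> $$ (j, k)) \<odot>\<^bsub>?F\<^esub> (free_gen j \<otimes>\<^bsub>?F\<^esub> free_gen k)) = \<zero>\<^bsub>B\<^esub>)"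
    unfolding torus_relations_def Let_def by blast
  also have "\<dots> \<longleftrightarrow> torus_tuple \<Theta> B (\<lambda>j. h (free_gen j))"
    unfolding torus_tuple_def by (simp add: s cong: conj_cong) blast
  finally show ?thesis by blast
qed

theorem nc_torus_relations: "torus_tuple \<Theta> (nc_torus \<Theta>) (torus_gen \<Theta>)"
proof -
  interpret bounded_relations "dim_row \<Theta>" "torus_relations \<Theta>" by (rule torus_bounded_relations)
  show ?thesis unfolding nc_torus_def torus_gen_def universal_gen_def[abs_def]
    using hom_torus_relations_iff[OF unital_cstar_algebra.axioms(1)[OF universal_cstar_algebra] const_cls_hom] const_cls_rel
    by blast
qed

theorem nc_torus_universal:
  assumes B: "unital_cstar_algebra B" and b: "torus_tuple \<Theta> B b"
  shows "\<exists>\<phi>\<in>unital_star_hom (nc_torus \<Theta>) B. \<forall>j<dim_row \<Theta>. \<phi> (torus_gen \<Theta> j) = b j"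
proof -
  interpret bounded_relations "dim_row \<Theta>" "torus_relations \<Theta>" by (rule torus_bounded_relations)
  interpret B: unital_cstar_algebra B by fact
  have bc: "\<And>j. j < dim_row \<Theta> \<Longrightarrow> b j \<in> carrier B" using b by (simp add: torus_tuple_def)
  note ev = B.eval_free_hom[of "dim_row \<Theta>" b, OF bc] B.eval_free_gen[of "dim_row \<Theta>" b, OF bc]
  have "torus_tuple \<Theta> B (\<lambda>j. B.eval_free b (free_gen j))"
    by (rule torus_tuple_cong[THEN iffD2, OF _ b]) (rule ev(2))
  then have "B.eval_free b r = \<zero>\<^bsub>B\<^esub>" if "r \<in> torus_relations \<Theta>" for r
    using hom_torus_relations_iff[OF B.unital_star_algebra_axioms ev(1)] that by blast
  then obtain \<phi> where \<phi>: "\<phi> \<in> unital_star_hom (nc_torus \<Theta>) B"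
      "\<forall>f\<in>carrier F. \<phi> (const_cls f) = B.eval_free b f"
    using universal_property[OF B ev(1)] unfolding nc_torus_def by blast
  have "\<phi> (torus_gen \<Theta> j) = b j" if j: "j < dim_row \<Theta>" for j
  proof -
    have "free_gen j \<in> carrier F" using j by (auto simp: free_gen_dirac intro!: dirac_carrier)
    then have "\<phi> (const_cls (free_gen j)) = b j" using \<phi>(2) ev(2)[OF _ j] by simp
    then show ?thesis by (simp only: torus_gen_def universal_gen_def)
  qed
  then show ?thesis using \<phi>(1) by blast
qed

end

theory Submission
  imports Defs "HOL-Library.Poly_Mapping" "HOL-Analysis.Inner_Product" "HOL-Analysis.Operator_Norm"
begin

text \<open>Write \<open>e(t) = e\<^bsup>2\<pi>it\<^esup>\<close>. In \<open>A\<^sub>\<Psi>\<close> the monomials are unitaries with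
  \<open>V\<^sup>y V\<^sup>x = e(x\<^sup>t\<Psi>y) V\<^sup>x V\<^sup>y\<close>, so the unitaries \<open>z\<^sub>j V\<^bsup>Me\<^sub>j\<^esup>\<close> commute up to the phases
  \<open>e((M\<^sup>t\<Psi>M)\<^sub>j\<^sub>k)\<close>. If these equal \<open>e(\<Theta>\<^sub>j\<^sub>k)\<close>, the universal property of \<open>A\<^sub>\<Theta>\<close> gives the
  homomorphism. Conversely a homomorphism forces \<open>e(\<Theta>\<^sub>j\<^sub>k) \<cdot> 1 = e((M\<^sup>t\<Psi>M)\<^sub>j\<^sub>k) \<cdot> 1\<close>, and the scalars
  agree because \<open>1 \<noteq> 0\<close> in \<open>A\<^sub>\<Psi>\<close>. This last fact needs a nonzero representation of the relations;
  a $C^*$-seminorm on the free algebra suffices, so twisted translations of a pre-Hilbert space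
  do and no completion is involved.\<close>

no_notation scalar_prod (infix "\<bullet>" 70)
unbundle inner_syntax

section \<open>Adjointable operators on a pre-Hilbert space\<close>

text \<open>Cauchy-Schwarz applied to the square of \<open>norm (S v)\<close>, written as
  \<open>T (S v) \<bullet> v\<close>; one factor \<open>norm (S v)\<close> then cancels.\<close>

lemma onorm_adjoint_le:
  fixes S T :: "'a::real_inner \<Rightarrow> 'a"
  assumes T: "bounded_linear T" and adj: "\<And>u v. T u \<bullet> v = u \<bullet> S v"
  shows "onorm S \<le> onorm T"
proof (rule onorm_bound[OF onorm_pos_le[OF T]])
  fix v
  have "(norm (S v))\<^sup>2 = T (S v) \<bullet> v" by (simp add: adj power2_norm_eq_inner)
  also have "\<dots> \<le> norm (T (S v)) * norm v" by (rule norm_cauchy_schwarz)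
  also have "\<dots> \<le> onorm T * norm (S v) * norm v" by (intro mult_right_mono onorm[OF T]) simp
  finally have "norm (S v) * norm (S v) \<le> norm (S v) * (onorm T * norm v)"
    by (simp add: power2_eq_square mult_ac)
  then show "norm (S v) \<le> onorm T * norm v"
    using onorm_pos_le[OF T] by (cases "S v = 0") auto
qed

text \<open>This is the $C^*$-identity for the operator norm. One inequality is submultiplicativity
  together with the bound on the adjoint; the other is Cauchy-Schwarz for
  \<open>v \<bullet> S (T v)\<close>, which is the square of \<open>norm (T v)\<close>.\<close>

lemma onorm_adjoint_comp:
  fixes S T :: "'a::real_inner \<Rightarrow> 'a"
  assumes T: "bounded_linear T" and S: "bounded_linear S" and adj: "\<And>u v. T u \<bullet> v = u \<bullet> S v"
  shows "onorm (S \<circ> T) = (onorm T)\<^sup>2"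
proof (rule antisym)
  have "onorm (S \<circ> T) \<le> onorm S * onorm T" by (rule onorm_compose[OF S T])
  also have "\<dots> \<le> onorm T * onorm T"
    by (rule mult_right_mono[OF onorm_adjoint_le[OF T adj] onorm_pos_le[OF T]])
  finally show "onorm (S \<circ> T) \<le> (onorm T)\<^sup>2" by (simp add: power2_eq_square)
  have ST: "bounded_linear (S \<circ> T)" unfolding o_def by (rule bounded_linear_compose[OF S T])
  have "onorm T \<le> sqrt (onorm (S \<circ> T))"
  proof (rule onorm_bound)
    show "0 \<le> sqrt (onorm (S \<circ> T))" using onorm_pos_le[OF ST] by simp
    fix v
    have "(norm (T v))\<^sup>2 = v \<bullet> (S \<circ> T) v" by (simp add: adj power2_norm_eq_inner)
    also have "\<dots> \<le> norm v * norm ((S \<circ> T) v)" by (rule norm_cauchy_schwarz)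
    also have "\<dots> \<le> norm v * (onorm (S \<circ> T) * norm v)" by (intro mult_left_mono onorm[OF ST]) simp
    finally have "(norm (T v))\<^sup>2 \<le> onorm (S \<circ> T) * (norm v)\<^sup>2" by (simp add: power2_eq_square mult_ac)
    then have "norm (T v) \<le> sqrt (onorm (S \<circ> T) * (norm v)\<^sup>2)" by (rule real_le_rsqrt)
    then show "norm (T v) \<le> sqrt (onorm (S \<circ> T)) * norm v" by (simp add: real_sqrt_mult)
  qed
  then have "(onorm T)\<^sup>2 \<le> (sqrt (onorm (S \<circ> T)))\<^sup>2" using onorm_pos_le[OF T] by (rule power_mono)
  then show "(onorm T)\<^sup>2 \<le> onorm (S \<circ> T)" using onorm_pos_le[OF ST] by simp
qed

section \<open>Finitely supported functions as a pre-Hilbert space\<close>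

text \<open>The algebraic direct sum of copies of \<open>'b\<close>. For \<open>'b = complex\<close>
  the inner product is the real part of the Hermitian one; for complex linear operators both give
  the same adjoints, as replacing u by iu recovers the imaginary part.\<close>

instantiation poly_mapping :: (type, real_inner) real_inner
begin

lift_definition scaleR_poly_mapping :: "real \<Rightarrow> ('a \<Rightarrow>\<^sub>0 'b) \<Rightarrow> 'a \<Rightarrow>\<^sub>0 'b" is "\<lambda>r f x. r *\<^sub>R f x"
  by (rule finite_subset[rotated]) auto

definition inner_poly_mapping :: "('a \<Rightarrow>\<^sub>0 'b) \<Rightarrow> ('a \<Rightarrow>\<^sub>0 'b) \<Rightarrow> real" where
  "inner_poly_mapping u v = (\<Sum>x\<in>Poly_Mapping.keys u. poly_mapping.lookup u x \<bullet> poly_mapping.lookup v x)"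

definition norm_poly_mapping :: "('a \<Rightarrow>\<^sub>0 'b) \<Rightarrow> real" where
  "norm_poly_mapping u = sqrt (u \<bullet> u)"

definition dist_poly_mapping :: "('a \<Rightarrow>\<^sub>0 'b) \<Rightarrow> ('a \<Rightarrow>\<^sub>0 'b) \<Rightarrow> real" where
  "dist_poly_mapping u v = norm (u - v)"

definition sgn_poly_mapping :: "('a \<Rightarrow>\<^sub>0 'b) \<Rightarrow> 'a \<Rightarrow>\<^sub>0 'b" where
  "sgn_poly_mapping u = inverse (norm u) *\<^sub>R u"

definition uniformity_poly_mapping :: "(('a \<Rightarrow>\<^sub>0 'b) \<times> ('a \<Rightarrow>\<^sub>0 'b)) filter" where
  "uniformity_poly_mapping = (INF e\<in>{0<..}. principal {(u, v). dist u v < e})"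

definition open_poly_mapping :: "('a \<Rightarrow>\<^sub>0 'b) set \<Rightarrow> bool" where
  "open_poly_mapping U = (\<forall>u\<in>U. eventually (\<lambda>(u', v). u' = u \<longrightarrow> v \<in> U) uniformity)"

text \<open>Supports change under addition, scaling and translation; sums over a common finite
  superset can be compared termwise.\<close>

lemma inner_poly_mapping_superset:
  assumes "finite A" "Poly_Mapping.keys u \<subseteq> A"
  shows "u \<bullet> v = (\<Sum>x\<in>A. poly_mapping.lookup u x \<bullet> poly_mapping.lookup v x)"
  unfolding inner_poly_mapping_def using assms
  by (intro sum.mono_neutral_left) (auto simp: in_keys_iff)

instance
proof
  fix u v w :: "'a \<Rightarrow>\<^sub>0 'b" and r s :: real
  show "r *\<^sub>R (u + v) = r *\<^sub>R u + r *\<^sub>R v" "(r + s) *\<^sub>R u = r *\<^sub>R u + s *\<^sub>R u"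
    "r *\<^sub>R s *\<^sub>R u = (r * s) *\<^sub>R u" "1 *\<^sub>R u = u"
    by (transfer; simp add: fun_eq_iff algebra_simps)+
  show "dist u v = norm (u - v)" "sgn u = inverse (norm u) *\<^sub>R u" "norm u = sqrt (u \<bullet> u)"
    by (fact dist_poly_mapping_def sgn_poly_mapping_def norm_poly_mapping_def)+
  show "uniformity = (INF e\<in>{0<..}. principal {(u, v::'a \<Rightarrow>\<^sub>0 'b). dist u v < e})"
    by (fact uniformity_poly_mapping_def)
  show "open U = (\<forall>u\<in>U. eventually (\<lambda>(u', v). u' = u \<longrightarrow> v \<in> U) uniformity)" for U :: "('a \<Rightarrow>\<^sub>0 'b) set"
    by (fact open_poly_mapping_def)
  let ?A = "Poly_Mapping.keys u \<union> Poly_Mapping.keys v"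
  have sup: "u \<bullet> w = (\<Sum>x\<in>?A. poly_mapping.lookup u x \<bullet> poly_mapping.lookup w x)"
    "v \<bullet> w = (\<Sum>x\<in>?A. poly_mapping.lookup v x \<bullet> poly_mapping.lookup w x)" for w
    by (rule inner_poly_mapping_superset; simp)+
  show "u \<bullet> v = v \<bullet> u" by (simp add: sup inner_commute)
  have "(u + v) \<bullet> w = (\<Sum>x\<in>?A. poly_mapping.lookup (u + v) x \<bullet> poly_mapping.lookup w x)"
    by (rule inner_poly_mapping_superset) (use keys_add[of u v] in auto)
  then show "(u + v) \<bullet> w = u \<bullet> w + v \<bullet> w" by (simp add: sup lookup_add inner_add_left sum.distrib)
  have "r *\<^sub>R u \<bullet> v = (\<Sum>x\<in>Poly_Mapping.keys u. poly_mapping.lookup (r *\<^sub>R u) x \<bullet> poly_mapping.lookup v x)"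
    by (rule inner_poly_mapping_superset) (auto simp: in_keys_iff scaleR_poly_mapping.rep_eq)
  then show "r *\<^sub>R u \<bullet> v = r * (u \<bullet> v)"
    by (simp add: inner_poly_mapping_def scaleR_poly_mapping.rep_eq sum_distrib_left)
  show "0 \<le> u \<bullet> u" by (simp add: inner_poly_mapping_def sum_nonneg)
  show "u \<bullet> u = 0 \<longleftrightarrow> u = 0"
    by (auto simp: inner_poly_mapping_def sum_nonneg_eq_0_iff in_keys_iff poly_mapping_eq_iff fun_eq_iff)
qed

end

section \<open>Complex scalars and adjointable operators\<close>

type_synonym 'i fin = "'i \<Rightarrow>\<^sub>0 complex"

definition cscale :: "complex \<Rightarrow> 'i fin \<Rightarrow> 'i fin" where
  "cscale c = Poly_Mapping.map ((*) c)"

lemma lookup_cscale [simp]: "poly_mapping.lookup (cscale c u) x = c * poly_mapping.lookup u x"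
  unfolding cscale_def by transfer (simp add: when_def)

lemma cscale_simps:
  "cscale c (u + v) = cscale c u + cscale c v" "cscale (c + d) u = cscale c u + cscale d u"
  "cscale c (cscale d u) = cscale (c * d) u" "cscale 1 u = u" "cscale c 0 = 0"
  "r *\<^sub>R u = cscale (of_real r) u"
  by (auto intro!: poly_mapping_eqI simp: lookup_add algebra_simps scaleR_poly_mapping.rep_eq scaleR_conv_of_real)

text \<open>Termwise this is Re((cx) cnj(y)) = Re(x cnj(cnj(c) y)).\<close>

lemma cscale_adjoint: "cscale c u \<bullet> v = u \<bullet> cscale (cnj c) v"
proof -
  have "cscale c u \<bullet> v = (\<Sum>x\<in>Poly_Mapping.keys u. poly_mapping.lookup (cscale c u) x \<bullet> poly_mapping.lookup v x)"
    by (rule inner_poly_mapping_superset) (auto simp: in_keys_iff)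
  then show ?thesis by (simp add: inner_poly_mapping_def inner_complex_def algebra_simps)
qed

lemma norm_cscale: "norm (cscale c u) = cmod c * norm u"
proof -
  have "cscale c u \<bullet> cscale c u = u \<bullet> cscale (cnj c * c) u"
    by (simp only: cscale_adjoint cscale_simps(3))
  also have "cscale (cnj c * c) u = (cmod c)\<^sup>2 *\<^sub>R u"
    by (simp add: cscale_simps(6) complex_norm_square[symmetric] mult.commute)
  finally show ?thesis by (simp add: norm_eq_sqrt_inner real_sqrt_mult)
qed

lemma bounded_linear_cscale: "bounded_linear (cscale c)"
  by (rule bounded_linear_intro[of _ "cmod c"]) (simp_all add: cscale_simps mult.commute norm_cscale)

lemma onorm_cscale:
  assumes "bounded_linear T" shows "onorm (\<lambda>v. cscale c (T v)) = cmod c * onorm T"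
proof -
  \<comment> \<open>Only norms of values enter \<open>onorm\<close>, so c may be replaced by the
    real scalar \<open>cmod c\<close>.\<close>
  have "onorm (\<lambda>v. cscale c (T v)) = onorm (\<lambda>v. cmod c *\<^sub>R T v)"
    by (simp add: onorm_def norm_cscale)
  then show ?thesis by (simp add: onorm_scaleR[OF assms])
qed

text \<open>An adjointable operator is stored together with its adjoint.\<close>

definition adj_pairs :: "(('i fin \<Rightarrow> 'i fin) \<times> ('i fin \<Rightarrow> 'i fin)) set" where
  "adj_pairs = {a. bounded_linear (fst a) \<and> bounded_linear (snd a) \<and>
     (\<forall>c v. fst a (cscale c v) = cscale c (fst a v)) \<and>
     (\<forall>c v. snd a (cscale c v) = cscale c (snd a v)) \<and>
     (\<forall>u v. fst a u \<bullet> v = u \<bullet> snd a v)}"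

text \<open>Carrying the adjoint along makes the star a swap, so no existence theorem for adjoints
  is involved. The second components therefore multiply in reverse order and scale by the
  conjugate.\<close>

definition adj_algebra :: "(('i fin \<Rightarrow> 'i fin) \<times> ('i fin \<Rightarrow> 'i fin)) star_algebra" where
  "adj_algebra = \<lparr> carrier = adj_pairs,
      monoid.mult = (\<lambda>a b. (fst a \<circ> fst b, snd b \<circ> snd a)),
      one = (id, id),
      zero = (\<lambda>v. 0, \<lambda>v. 0),
      add = (\<lambda>a b. (\<lambda>v. fst a v + fst b v, \<lambda>v. snd a v + snd b v)),
      smult = (\<lambda>c a. (\<lambda>v. cscale c (fst a v), \<lambda>v. cscale (cnj c) (snd a v))),
      star = prod.swap \<rparr>"

lemma adj_pairsD:
  assumes "a \<in> adj_pairs"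
  shows "bounded_linear (fst a)" "bounded_linear (snd a)"
    "fst a (cscale c v) = cscale c (fst a v)" "snd a (cscale c v) = cscale c (snd a v)"
    "fst a u \<bullet> w = u \<bullet> snd a w" "w \<bullet> fst a u = snd a w \<bullet> u"
    "fst a (x + y) = fst a x + fst a y" "snd a (x + y) = snd a x + snd a y"
  using assms by (auto simp: adj_pairs_def inner_commute bounded_linear.linear linear_add)

lemma adj_algebra_simps:
  "carrier adj_algebra = adj_pairs"
  "a \<otimes>\<^bsub>adj_algebra\<^esub> b = (fst a \<circ> fst b, snd b \<circ> snd a)"
  "\<one>\<^bsub>adj_algebra\<^esub> = (id, id)"
  "\<zero>\<^bsub>adj_algebra\<^esub> = (\<lambda>v. 0, \<lambda>v. 0)"
  "a \<oplus>\<^bsub>adj_algebra\<^esub> b = (\<lambda>v. fst a v + fst b v, \<lambda>v. snd a v + snd b v)"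
  "c \<odot>\<^bsub>adj_algebra\<^esub> a = (\<lambda>v. cscale c (fst a v), \<lambda>v. cscale (cnj c) (snd a v))"
  "star adj_algebra a = prod.swap a"
  by (simp_all add: adj_algebra_def)

lemma adj_algebra_closed:
  assumes "a \<in> adj_pairs" "b \<in> adj_pairs"
  shows "(fst a \<circ> fst b, snd b \<circ> snd a) \<in> adj_pairs"
    "(\<lambda>v. fst a v + fst b v, \<lambda>v. snd a v + snd b v) \<in> adj_pairs"
    "(\<lambda>v. cscale c (fst a v), \<lambda>v. cscale (cnj c) (snd a v)) \<in> adj_pairs"
    "prod.swap a \<in> adj_pairs"
  unfolding adj_pairs_def using assms
  by (auto simp: adj_pairsD o_def cscale_adjoint cscale_simps mult.commute inner_add_left inner_add_right
      intro!: bounded_linear_add bounded_linear_compose[OF bounded_linear_cscale] intro: bounded_linear_compose)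

lemma adj_unital_star_algebra: "unital_star_algebra adj_algebra"
proof -
  have one_zero: "(id, id) \<in> adj_pairs" "(\<lambda>v. 0, \<lambda>v. 0) \<in> adj_pairs"
    by (simp_all add: adj_pairs_def id_def cscale_simps)
  have "abelian_group adj_algebra"
  proof (rule abelian_groupI)
    fix x :: "('i fin \<Rightarrow> 'i fin) \<times> ('i fin \<Rightarrow> 'i fin)" assume x: "x \<in> carrier adj_algebra"
    have "cscale (-1) v + v = 0" for v :: "'i fin"
      by (auto intro!: poly_mapping_eqI simp: lookup_add)
    then show "\<exists>y\<in>carrier adj_algebra. y \<oplus>\<^bsub>adj_algebra\<^esub> x = \<zero>\<^bsub>adj_algebra\<^esub>"
      using x adj_algebra_closed(3)[of x x "-1"]
      by (intro bexI[of _ "(-1) \<odot>\<^bsub>adj_algebra\<^esub> x"]) (simp_all add: adj_algebra_simps)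
  qed (auto simp: adj_algebra_simps adj_algebra_closed one_zero add_ac)
  moreover have "Group.monoid adj_algebra"
    by (rule monoidI) (auto simp: adj_algebra_simps adj_algebra_closed one_zero o_assoc)
  ultimately have "ring adj_algebra"
    by (rule ringI) (auto simp: adj_algebra_simps o_def adj_pairsD)
  then show ?thesis
    by (intro unital_star_algebra.intro unital_star_algebra_axioms.intro)
       (auto simp: adj_algebra_simps adj_algebra_closed adj_pairsD cscale_simps o_def mult.commute)
qed

text \<open>The $C^*$-identity is \<open>onorm_adjoint_comp\<close>, the adjoint being the second
  component. Homomorphisms from the free algebra can now pull this seminorm back.\<close>

lemma adj_cstar_seminorm: "cstar_seminorm adj_algebra (\<lambda>a. onorm (fst a))"
  unfolding cstar_seminorm_def
proof (intro conjI ballI allI; unfold adj_algebra_simps)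
  fix a b :: "('i fin \<Rightarrow> 'i fin) \<times> ('i fin \<Rightarrow> 'i fin)" and c
  assume a: "a \<in> adj_pairs"
  show "0 \<le> onorm (fst a)" by (rule onorm_pos_le[OF adj_pairsD(1)[OF a]])
  show "onorm (fst (\<lambda>v. cscale c (fst a v), \<lambda>v. cscale (cnj c) (snd a v))) = cmod c * onorm (fst a)"
    by (simp add: onorm_cscale[OF adj_pairsD(1)[OF a]])
  show "onorm (fst (fst (prod.swap a) \<circ> fst a, snd a \<circ> snd (prod.swap a))) = (onorm (fst a))\<^sup>2"
    using a by (simp add: onorm_adjoint_comp adj_pairsD)
  assume b: "b \<in> adj_pairs"
  show "onorm (fst (\<lambda>v. fst a v + fst b v, \<lambda>v. snd a v + snd b v)) \<le> onorm (fst a) + onorm (fst b)"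
    using a b by (simp add: onorm_triangle adj_pairsD)
  show "onorm (fst (fst a \<circ> fst b, snd b \<circ> snd a)) \<le> onorm (fst a) * onorm (fst b)"
    using a b by (simp add: onorm_compose adj_pairsD)
qed

section \<open>Weighted translations\<close>

text \<open>The weighted composition operator sending v to c times v \<circ> \<sigma>. A bijective
  \<sigma> preserves finite supports; the value 0 for any other \<sigma> only makes the operation
  total.\<close>

lift_definition wcomp :: "('i \<Rightarrow> complex) \<Rightarrow> ('i \<Rightarrow> 'i) \<Rightarrow> 'i fin \<Rightarrow> 'i fin"
  is "\<lambda>c \<sigma> v x. if bij \<sigma> then c x * v (\<sigma> x) else 0"
proof -
  fix c :: "'i \<Rightarrow> complex" and \<sigma> :: "'i \<Rightarrow> 'i" and v :: "'i \<Rightarrow> complex"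
  assume fin: "finite {x. v x \<noteq> 0}"
  have "finite (\<sigma> -` {x. v x \<noteq> 0})" if "bij \<sigma>"
    using fin that by (intro finite_vimageI) (auto simp: bij_def)
  moreover have "{x. (if bij \<sigma> then c x * v (\<sigma> x) else 0) \<noteq> 0} \<subseteq> \<sigma> -` {x. v x \<noteq> 0}"
    by (auto split: if_splits)
  ultimately show "finite {x. (if bij \<sigma> then c x * v (\<sigma> x) else 0) \<noteq> 0}"
    by (cases "bij \<sigma>") (auto intro: finite_subset)
qed

lemma lookup_wcomp:
  "bij \<sigma> \<Longrightarrow> poly_mapping.lookup (wcomp c \<sigma> v) x = c x * poly_mapping.lookup v (\<sigma> x)"
  by (simp add: wcomp.rep_eq)

lemma wcomp_wcomp:
  assumes "bij \<sigma>" "bij \<rho>"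
  shows "wcomp c \<sigma> (wcomp d \<rho> v) = wcomp (\<lambda>x. c x * d (\<sigma> x)) (\<rho> \<circ> \<sigma>) v"
  using assms by (intro poly_mapping_eqI) (simp add: lookup_wcomp bij_comp)

lemma wcomp_one: "wcomp (\<lambda>x. 1) id v = v"
  by (intro poly_mapping_eqI) (simp add: lookup_wcomp)

text \<open>Substitute x = \<tau> y in the inner product. If x lies in the support of the left
  argument, then \<sigma> x lies in that of u, so x = \<tau> (\<sigma> x) is in the image over which
  the sum is taken.\<close>

lemma wcomp_adjoint:
  assumes inv: "\<tau> \<circ> \<sigma> = id" "\<sigma> \<circ> \<tau> = id"
  shows "wcomp c \<sigma> u \<bullet> v = u \<bullet> wcomp (\<lambda>y. cnj (c (\<tau> y))) \<tau> v"
proof -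
  have bij: "bij \<sigma>" "bij \<tau>" by (rule o_bij[OF inv] o_bij[OF inv(2) inv(1)])+
  have pt: "\<tau> (\<sigma> x) = x" "\<sigma> (\<tau> x) = x" for x using inv by (simp_all add: fun_eq_iff)
  have "wcomp c \<sigma> u \<bullet> v =
      (\<Sum>x\<in>\<tau> ` Poly_Mapping.keys u. poly_mapping.lookup (wcomp c \<sigma> u) x \<bullet> poly_mapping.lookup v x)"
    by (intro inner_poly_mapping_superset)
      (auto simp: in_keys_iff lookup_wcomp bij pt intro!: image_eqI[of _ _ "\<sigma> _"])
  also have "\<dots> = (\<Sum>y\<in>Poly_Mapping.keys u. poly_mapping.lookup (wcomp c \<sigma> u) (\<tau> y) \<bullet> poly_mapping.lookup v (\<tau> y))"
    by (subst sum.reindex) (auto intro: inj_on_inverseI[of _ \<sigma>] simp: pt)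
  also have "\<dots> = u \<bullet> wcomp (\<lambda>y. cnj (c (\<tau> y))) \<tau> v"
    unfolding inner_poly_mapping_def
    by (intro sum.cong refl) (simp add: lookup_wcomp bij pt inner_complex_def algebra_simps)
  finally show ?thesis .
qed

text \<open>For weights of modulus one the adjoint is a two-sided inverse. Both operators are then
  isometric, which supplies the boundedness required by \<open>adj_pairs\<close>.\<close>

lemma wcomp_unitary:
  assumes inv: "\<tau> \<circ> \<sigma> = id" "\<sigma> \<circ> \<tau> = id" and c: "\<And>x. cmod (c x) = 1"
  defines "S \<equiv> wcomp (\<lambda>y. cnj (c (\<tau> y))) \<tau>"
  shows "S \<circ> wcomp c \<sigma> = id" "wcomp c \<sigma> \<circ> S = id" "(wcomp c \<sigma>, S) \<in> adj_pairs"
proof -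
  have bij: "bij \<sigma>" "bij \<tau>" by (rule o_bij[OF inv] o_bij[OF inv(2) inv(1)])+
  have pt: "\<tau> (\<sigma> x) = x" "\<sigma> (\<tau> x) = x" for x using inv by (simp_all add: fun_eq_iff)
  have c1: "c x * cnj (c x) = 1" "cnj (c x) * c x = 1" for x
    using c[of x] complex_norm_square[of "c x"] by (simp_all add: mult.commute)
  show SW: "S \<circ> wcomp c \<sigma> = id" and WS: "wcomp c \<sigma> \<circ> S = id"
    by (auto simp: fun_eq_iff S_def wcomp_wcomp bij c1 inv pt wcomp_one)
  have blin: "bounded_linear (wcomp d \<rho>)" "wcomp d \<rho> (cscale r v) = cscale r (wcomp d \<rho> v)"
    if "bij \<rho>" "\<And>v. norm (wcomp d \<rho> v) = norm v" for d :: "'i \<Rightarrow> complex" and \<rho> r v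
  proof -
    show "bounded_linear (wcomp d \<rho>)"
      by (rule bounded_linear_intro[of _ 1])
        (auto intro!: poly_mapping_eqI simp: that lookup_wcomp lookup_add scaleR_poly_mapping.rep_eq algebra_simps)
    show "wcomp d \<rho> (cscale r v) = cscale r (wcomp d \<rho> v)"
      by (rule poly_mapping_eqI) (simp add: that lookup_wcomp)
  qed
  have adj: "wcomp c \<sigma> u \<bullet> v = u \<bullet> S v" for u v unfolding S_def by (rule wcomp_adjoint[OF inv])
  have n1: "norm (wcomp c \<sigma> v) = norm v" for v
    using SW by (simp add: norm_eq_sqrt_inner adj fun_eq_iff)
  \<comment> \<open>\<open>wcomp c \<sigma>\<close> is isometric and sends S v to v.\<close>
  have n2: "norm (S v) = norm v" for v
    using WS n1[of "S v"] by (simp add: fun_eq_iff)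
  show "(wcomp c \<sigma>, S) \<in> adj_pairs"
    using blin[OF bij(1) n1] blin[OF bij(2) n2[unfolded S_def]] adj by (simp add: adj_pairs_def S_def)
qed

section \<open>Unitaries commuting up to a phase\<close>

text \<open>Translates between equal phases and real exponents congruent modulo the integers, for
  both directions of the theorem.\<close>

lemma exp_two_pi_i_eq_iff:
  "exp (2 * complex_of_real pi * \<i> * complex_of_real s) = exp (2 * complex_of_real pi * \<i> * complex_of_real t)
     \<longleftrightarrow> s - t \<in> \<int>"
proof -
  have cis: "exp (2 * complex_of_real pi * \<i> * complex_of_real r) = cis (2 * pi * r)" for r
    by (simp add: cis_conv_exp mult_ac)
  have "2 * pi * s = 2 * pi * t + 2 * pi * of_int k \<longleftrightarrow> s - t = of_int k" for k :: int
  proof -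
    have "2 * pi * t + 2 * pi * of_int k = 2 * pi * (t + of_int k)" by (simp add: algebra_simps)
    then show ?thesis by (simp only: mult_cancel_left) auto
  qed
  then show ?thesis
    using sin_cos_eq_iff[of "2 * pi * s" "2 * pi * t"]
    by (auto simp: cis complex_eq_iff Ints_def)
qed

context unital_star_algebra
begin

definition unitaries :: "'a set" where
  "unitaries = {u \<in> carrier A. star A u \<otimes> u = \<one> \<and> u \<otimes> star A u = \<one>}"

text \<open>The parameter is the exponent and not the phase, so that it adds under products. The
  order of arguments matches the torus relations: \<Theta> at (j, k) belongs to the pair (U_j,
  U_k).\<close>

definition qcomm :: "real \<Rightarrow> 'a \<Rightarrow> 'a \<Rightarrow> bool" where
  "qcomm t u v \<longleftrightarrow> v \<otimes> u = exp (2 * pi * \<i> * t) \<odot> (u \<otimes> v)"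

lemma unitariesD:
  assumes "u \<in> unitaries"
  shows "u \<in> carrier A" "star A u \<in> carrier A" "star A u \<otimes> u = \<one>" "u \<otimes> star A u = \<one>"
  using assms by (auto simp: unitaries_def star_closed)

lemma unitaries_one: "\<one> \<in> unitaries"
  by (simp add: unitaries_def star_one)

lemma unitaries_mult:
  assumes u: "u \<in> unitaries" and v: "v \<in> unitaries" shows "u \<otimes> v \<in> unitaries"
proof -
  note c = unitariesD[OF u] unitariesD[OF v]
  have "star A v \<otimes> star A u \<otimes> (u \<otimes> v) = star A v \<otimes> (star A u \<otimes> u) \<otimes> v"
    "u \<otimes> v \<otimes> (star A v \<otimes> star A u) = u \<otimes> (v \<otimes> star A v) \<otimes> star A u"
    using c(1,2,5,6) by (simp_all add: m_assoc)
  then show ?thesis using c by (simp add: unitaries_def star_mult)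
qed

lemma unitaries_star: "u \<in> unitaries \<Longrightarrow> star A u \<in> unitaries"
  by (auto simp: unitaries_def star_closed star_star)

lemma unitaries_smult:
  assumes u: "u \<in> unitaries" and c: "cmod c = 1" shows "c \<odot> u \<in> unitaries"
proof -
  have "c * cnj c = 1" using c complex_norm_square[of c] by simp
  then show ?thesis using unitariesD[OF u]
    by (simp add: unitaries_def smult_closed star_smult smult_mult_left smult_mult_right
        smult_smult smult_one mult.commute)
qed

text \<open>Negative powers are defined through the monoid inverse; identifying it with the star
  lets the rules for adjoints handle them.\<close>

lemma unitaries_inv: "u \<in> unitaries \<Longrightarrow> inv u = star A u"
  using unitariesD by (intro inv_char) auto

lemma unitaries_nat_pow: "u \<in> unitaries \<Longrightarrow> u [^] (k::nat) \<in> unitaries"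
  by (induction k) (auto intro: unitaries_one unitaries_mult)

lemma unitaries_int_pow: "u \<in> unitaries \<Longrightarrow> u [^] (k::int) \<in> unitaries"
  by (cases "k < 0")
    (simp_all only: int_pow_def2 if_True if_False unitaries_inv unitaries_nat_pow unitaries_star)

lemma unitaries_foldr:
  "(\<And>j. j \<in> set js \<Longrightarrow> f j \<in> unitaries) \<Longrightarrow> foldr (\<otimes>) (map f js) \<one> \<in> unitaries"
  by (induction js) (auto intro: unitaries_one unitaries_mult)

lemma qcomm_one: "u \<in> carrier A \<Longrightarrow> qcomm 0 u \<one>"
  by (simp add: qcomm_def smult_one)

text \<open>Move u to the left past w, then past v; the two phases multiply.\<close>

lemma qcomm_mult:
  assumes c: "u \<in> carrier A" "v \<in> carrier A" "w \<in> carrier A" and q: "qcomm s u v" "qcomm t u w"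
  shows "qcomm (s + t) u (v \<otimes> w)"
proof -
  let ?e = "\<lambda>t::real. exp (2 * pi * \<i> * t)"
  have "v \<otimes> w \<otimes> u = v \<otimes> (?e t \<odot> (u \<otimes> w))" using q c by (simp add: m_assoc qcomm_def)
  also have "\<dots> = ?e t \<odot> ((v \<otimes> u) \<otimes> w)" using c by (simp add: smult_mult_right m_assoc)
  also have "\<dots> = (?e t * ?e s) \<odot> (u \<otimes> (v \<otimes> w))"
    using q c by (simp add: qcomm_def smult_mult_left smult_smult m_assoc)
  also have "?e t * ?e s = ?e (s + t)" by (simp add: exp_add[symmetric] algebra_simps)
  finally show ?thesis by (simp add: qcomm_def)
qed

lemma qcomm_sym:
  assumes c: "u \<in> carrier A" "v \<in> carrier A" and q: "qcomm t u v"
  shows "qcomm (- t) v u"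
proof -
  have "exp (2 * pi * \<i> * complex_of_real (- t)) * exp (2 * pi * \<i> * complex_of_real t) = 1"
    by (simp add: exp_add[symmetric])
  then show ?thesis using q c by (simp add: qcomm_def smult_smult smult_one del: of_real_minus)
qed

text \<open>Multiplying v u = e(t) u v by the star of v on both sides gives the relation with the
  two factors exchanged, and \<open>qcomm_sym\<close> turns it around.\<close>

lemma qcomm_star:
  assumes u: "u \<in> carrier A" and v: "v \<in> unitaries" and q: "qcomm t u v"
  shows "qcomm (- t) u (star A v)"
proof -
  note c = u unitariesD[OF v]
  have "u \<otimes> star A v = star A v \<otimes> (v \<otimes> u) \<otimes> star A v"
    using c by (simp add: m_assoc[symmetric])
  also have "\<dots> = exp (2 * pi * \<i> * t) \<odot> (star A v \<otimes> u \<otimes> (v \<otimes> star A v))"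
    using q c(1-3) by (simp add: qcomm_def smult_mult_right smult_mult_left m_assoc)
  finally have "qcomm t (star A v) u" using c by (simp add: qcomm_def)
  then show ?thesis using c by (intro qcomm_sym)
qed

lemma qcomm_nat_pow:
  assumes c: "u \<in> carrier A" "v \<in> carrier A" and q: "qcomm t u v"
  shows "qcomm (real k * t) u (v [^] k)"
proof (induction k)
  case 0 then show ?case using c by (simp add: qcomm_one)
next
  case (Suc k)
  have "qcomm (real k * t + t) u (v [^] k \<otimes> v)" by (intro qcomm_mult Suc.IH q c) (simp add: c)
  then show ?case by (simp add: algebra_simps)
qed

lemma qcomm_int_pow:
  assumes u: "u \<in> carrier A" and v: "v \<in> unitaries" and q: "qcomm t u v"
  shows "qcomm (of_int k * t) u (v [^] (k::int))"
proof (cases "k < 0")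
  case True
  have "qcomm (- (real (nat (- k)) * t)) u (star A (v [^] nat (- k)))"
    by (intro qcomm_star qcomm_nat_pow u unitaries_nat_pow v unitariesD(1)[OF v] q)
  moreover have "v [^] k = star A (v [^] nat (- k))"
    using True v by (simp only: int_pow_def2 if_True unitaries_inv unitaries_nat_pow)
  moreover have "of_int k * t = - (real (nat (- k)) * t)" using True by simp
  ultimately show ?thesis by (simp only:)
next
  case False
  have "qcomm (real (nat k) * t) u (v [^] nat k)"
    by (intro qcomm_nat_pow u unitariesD(1)[OF v] q)
  moreover have "v [^] k = v [^] nat k" using False by (simp only: int_pow_def2 if_False)
  moreover have "of_int k * t = real (nat k) * t" using False by simp
  ultimately show ?thesis by (simp only:)
qed

lemma qcomm_foldr:
  assumes "u \<in> carrier A" "\<And>j. j \<in> set js \<Longrightarrow> f j \<in> unitaries" "\<And>j. j \<in> set js \<Longrightarrow> qcomm (t j) u (f j)"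
  shows "qcomm (\<Sum>j\<leftarrow>js. t j) u (foldr (\<otimes>) (map f js) \<one>)"
  using assms(2,3)
proof (induction js)
  case Nil then show ?case using assms(1) by (simp add: qcomm_one)
next
  case (Cons j js)
  have "foldr (\<otimes>) (map f js) \<one> \<in> unitaries" using Cons.prems by (intro unitaries_foldr) auto
  then show ?case using Cons assms(1) by (auto intro!: qcomm_mult dest: unitariesD(1))
qed

text \<open>Scalars are central and occur on both sides of the relation, so passing from V^{Me_j} to
  its multiple by z_j leaves the exponent unchanged.\<close>

lemma qcomm_smult:
  "u \<in> carrier A \<Longrightarrow> v \<in> carrier A \<Longrightarrow> qcomm t u v \<Longrightarrow> qcomm t (c \<odot> u) (d \<odot> v)"
  by (simp add: qcomm_def smult_mult_left smult_mult_right smult_smult smult_closed mult_ac)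

text \<open>Cancelling the unitary u v leaves two equal scalar multiples of \<one>. If the scalars
  differed, dividing by their difference would give \<one> = \<zero>.\<close>

lemma qcomm_unique:
  assumes u: "u \<in> unitaries" and v: "v \<in> unitaries" and q: "qcomm s u v" "qcomm t u v"
    and nontrivial: "\<one> \<noteq> \<zero>"
  shows "s - t \<in> \<int>"
proof -
  let ?s = "exp (2 * pi * \<i> * s)" and ?t = "exp (2 * pi * \<i> * t)"
  note w = unitariesD[OF unitaries_mult[OF u v]]
  have "?s \<odot> (u \<otimes> v) \<otimes> star A (u \<otimes> v) = ?t \<odot> (u \<otimes> v) \<otimes> star A (u \<otimes> v)"
    using q by (simp add: qcomm_def)
  then have eq: "?s \<odot> \<one> = ?t \<odot> \<one>" using w by (simp add: smult_mult_left)
  have "?s = ?t"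
  proof (rule ccontr)
    assume ne: "?s \<noteq> ?t"
    have "(?s - ?t) \<odot> \<one> = ?s \<odot> \<one> \<oplus> (- ?t) \<odot> \<one>" by (simp add: smult_l_distr[symmetric])
    also have "\<dots> = (?t + - ?t) \<odot> \<one>" unfolding eq by (simp only: smult_l_distr one_closed)
    also have "\<dots> = \<zero>" by (simp add: smult_zero)
    finally have "inverse (?s - ?t) \<odot> ((?s - ?t) \<odot> \<one>) = \<zero>" by (simp add: smult_r_zero)
    then show False using ne nontrivial by (simp add: smult_smult smult_one)
  qed
  then show ?thesis by (simp add: exp_two_pi_i_eq_iff)
qed

lemma torus_tuple_iff:
  "torus_tuple \<Theta> A b \<longleftrightarrow> (\<forall>j<dim_row \<Theta>. b j \<in> unitaries) \<and>
     (\<forall>j<dim_row \<Theta>. \<forall>k<dim_row \<Theta>. qcomm (\<Theta> $$ (j, k)) (b j) (b k))"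
  by (simp add: torus_tuple_def unitaries_def qcomm_def)

end

section \<open>Ordered monomials in a noncommutative torus\<close>

lemma torus_monom_unitary:
  "torus_monom \<Psi> x \<in> unital_star_algebra.unitaries (nc_torus \<Psi>)"
proof -
  interpret unital_star_algebra "nc_torus \<Psi>"
    by (rule unital_cstar_algebra.axioms(1)[OF nc_torus_cstar])
  show ?thesis using nc_torus_relations[of \<Psi>] unfolding torus_monom_def torus_tuple_iff
    by (intro unitaries_foldr unitaries_int_pow) auto
qed

text \<open>The exponent is the bilinear form of \<Psi>. \<open>qcomm_foldr\<close> expands only the
  second argument, so V^y is expanded against each generator, the relation is reversed, V^x is
  expanded, and the relation is reversed again; the two signs cancel.\<close>

lemma torus_monom_qcomm:
  "unital_star_algebra.qcomm (nc_torus \<Psi>)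
     (\<Sum>a<dim_row \<Psi>. \<Sum>b<dim_row \<Psi>. of_int (x $ a) * \<Psi> $$ (a, b) * of_int (y $ b))
     (torus_monom \<Psi> x) (torus_monom \<Psi> y)"
proof -
  interpret unital_star_algebra "nc_torus \<Psi>"
    by (rule unital_cstar_algebra.axioms(1)[OF nc_torus_cstar])
  let ?V = "torus_gen \<Psi>" and ?n = "dim_row \<Psi>"
  have V: "?V a \<in> unitaries" if "a < ?n" for a
    using nc_torus_relations[of \<Psi>] that by (simp add: torus_tuple_iff)
  have VV: "qcomm (\<Psi> $$ (a, b)) (?V a) (?V b)" if "a < ?n" "b < ?n" for a b
    using nc_torus_relations[of \<Psi>] that by (simp add: torus_tuple_iff)
  have mon: "torus_monom \<Psi> y \<in> unitaries" for y by (rule torus_monom_unitary)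
  note car = unitariesD(1)
  have foldr: "qcomm (\<Sum>b<?n. of_int (y $ b) * t b) u (torus_monom \<Psi> y)"
    if "u \<in> unitaries" "\<And>b. b < ?n \<Longrightarrow> qcomm (t b) u (?V b)" for u t y
  proof -
    have "qcomm (\<Sum>b\<leftarrow>[0..<?n]. of_int (y $ b) * t b) u (torus_monom \<Psi> y)"
      unfolding torus_monom_def using that V
      by (intro qcomm_foldr unitaries_int_pow qcomm_int_pow) (auto intro: car)
    then show ?thesis by (simp add: interv_sum_list_conv_sum_set_nat atLeast0LessThan)
  qed
  have "qcomm (\<Sum>b<?n. of_int (y $ b) * \<Psi> $$ (a, b)) (?V a) (torus_monom \<Psi> y)" if "a < ?n" for a
    using that by (intro foldr V VV)
  then have "qcomm (- (\<Sum>b<?n. of_int (y $ b) * \<Psi> $$ (a, b))) (torus_monom \<Psi> y) (?V a)" if "a < ?n" for a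
    using that by (intro qcomm_sym car[OF V] car[OF mon])
  then have "qcomm (\<Sum>a<?n. of_int (x $ a) * - (\<Sum>b<?n. of_int (y $ b) * \<Psi> $$ (a, b)))
      (torus_monom \<Psi> y) (torus_monom \<Psi> x)"
    by (intro foldr mon)
  then have "qcomm (- (\<Sum>a<?n. of_int (x $ a) * - (\<Sum>b<?n. of_int (y $ b) * \<Psi> $$ (a, b))))
      (torus_monom \<Psi> x) (torus_monom \<Psi> y)"
    by (intro qcomm_sym car[OF mon])
  then show ?thesis by (simp add: sum_negf sum_distrib_left mult_ac)
qed

section \<open>Nontriviality of noncommutative tori\<close>

text \<open>The pullback of p along h is a $C^*$-seminorm vanishing on R, hence one of those in the
  supremum. In contrast to \<open>universal_property\<close>, B only carries a seminorm.\<close>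

lemma (in bounded_relations) universal_seminorm_ge:
  assumes B: "seminormed_star_algebra B p" and h: "h \<in> unital_star_hom F B"
    and hR: "\<And>r. r \<in> R \<Longrightarrow> h r = \<zero>\<^bsub>B\<^esub>" and f: "f \<in> carrier F"
  shows "p (h f) \<le> us f"
proof (rule us_upper[OF f, of "\<lambda>f. p (h f)"])
  interpret B: seminormed_star_algebra B p by fact
  have "h \<in> star_hom F B" using h by (simp add: unital_star_hom_def)
  note hD = star_homD[OF this]
  show "(\<lambda>f. p (h f)) \<in> SN"
    unfolding cstar_seminorm_def mem_Collect_eq
    by (intro conjI ballI allI)
      (simp_all add: hD F.smult_closed F.star_closed B.p_nonneg B.p_smult B.p_add B.p_mult B.p_cstar hR)
qed

text \<open>Adjoints are unique because the inner product is definite, so relations need checking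
  only on first components.\<close>

lemma adj_pairs_eqI:
  assumes "a \<in> adj_pairs" "b \<in> adj_pairs" "fst a = fst b" shows "a = b"
proof -
  have "u \<bullet> snd a v = u \<bullet> snd b v" for u v using assms adj_pairsD(5) by metis
  then have "(snd a v - snd b v) \<bullet> (snd a v - snd b v) = 0" for v by (simp add: inner_diff_right)
  then have "snd a v = snd b v" for v by simp
  then show ?thesis using assms(3) by (simp add: prod_eq_iff fun_eq_iff)
qed

lemma skew_matsD:
  assumes "A \<in> skew_mats n"
  shows "A \<in> carrier_mat n n" "\<lbrakk>j < n; k < n\<rbrakk> \<Longrightarrow> A $$ (k, j) = - A $$ (j, k)"
proof -
  have A: "A \<in> carrier_mat n n" "transpose_mat A = - A" using assms by (auto simp: skew_mats_def)
  show "A \<in> carrier_mat n n" by (rule A)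
  show "A $$ (k, j) = - A $$ (j, k)" if "j < n" "k < n"
    using that A by (metis carrier_matD index_transpose_mat(1) index_uminus_mat(1))
qed

text \<open>The tori act on finitely supported functions on the lattice, here \<open>nat \<Rightarrow> int\<close>, by
  \<open>V\<^sub>j \<delta>\<^sub>x = e\<^bsup>\<pi>i \<Sum>\<^sub>l \<Theta>\<^sub>l\<^sub>j x\<^sub>l\<^esup> \<delta>\<^bsub>x + e\<^sub>j\<^esub>\<close>: exchanging two shifts contributes half of the
  phase \<open>2\<pi>\<Theta>\<^sub>j\<^sub>k\<close>, and skew symmetry the other half. As \<open>\<Theta>\<^sub>j\<^sub>j = 0\<close>, the phase of \<open>V\<^sub>j\<close> may be
  evaluated at the target instead of the source.\<close>

definition weyl_phase :: "real mat \<Rightarrow> nat \<Rightarrow> (nat \<Rightarrow> int) \<Rightarrow> complex" where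
  "weyl_phase \<Theta> j x = cis (pi * (\<Sum>l<dim_row \<Theta>. \<Theta> $$ (l, j) * of_int (x l)))"

text \<open>Composition with the shift by -e_j moves the point mass at x to x + e_j. The second
  component is the adjoint in the form that \<open>wcomp_unitary\<close> provides.\<close>

definition weyl_gen :: "real mat \<Rightarrow> nat \<Rightarrow> ((nat \<Rightarrow> int) fin \<Rightarrow> (nat \<Rightarrow> int) fin) \<times> ((nat \<Rightarrow> int) fin \<Rightarrow> (nat \<Rightarrow> int) fin)" where
  "weyl_gen \<Theta> j = (wcomp (weyl_phase \<Theta> j) (\<lambda>x. x(j := x j - 1)),
     wcomp (\<lambda>x. cnj (weyl_phase \<Theta> j (x(j := x j + 1)))) (\<lambda>x. x(j := x j + 1)))"

lemma weyl_phase_shift: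
  assumes "k < dim_row \<Theta>"
  shows "weyl_phase \<Theta> j (x(k := x k - 1)) = weyl_phase \<Theta> j x * cis (- (pi * \<Theta> $$ (k, j)))"
proof -
  have "(\<Sum>l<dim_row \<Theta>. \<Theta> $$ (l, j) * of_int ((x(k := x k - 1)) l)) =
      (\<Sum>l<dim_row \<Theta>. \<Theta> $$ (l, j) * of_int (x l) - (if l = k then \<Theta> $$ (k, j) else 0))"
    by (intro sum.cong) (auto simp: algebra_simps)
  also have "\<dots> = (\<Sum>l<dim_row \<Theta>. \<Theta> $$ (l, j) * of_int (x l)) - \<Theta> $$ (k, j)"
    using assms by (simp add: sum_subtractf)
  finally show ?thesis unfolding weyl_phase_def by (simp add: cis_mult right_diff_distrib)
qed

text \<open>The shifts commute, so each commutation relation reduces to an identity between the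
  weights of the two products.\<close>

lemma weyl_gen_torus_tuple:
  assumes skew: "\<Theta> \<in> skew_mats n"
  shows "torus_tuple \<Theta> adj_algebra (weyl_gen \<Theta>)"
proof -
  interpret unital_star_algebra "adj_algebra :: (((nat \<Rightarrow> int) fin \<Rightarrow> (nat \<Rightarrow> int) fin) \<times> _) star_algebra"
    by (rule adj_unital_star_algebra)
  have n: "dim_row \<Theta> = n" using skew_matsD(1)[OF skew] by simp
  have shift_inv: "(\<lambda>x::nat \<Rightarrow> int. x(j := x j + 1)) \<circ> (\<lambda>x. x(j := x j - 1)) = id"
    "(\<lambda>x::nat \<Rightarrow> int. x(j := x j - 1)) \<circ> (\<lambda>x. x(j := x j + 1)) = id" for j :: nat
    by (auto simp: fun_eq_iff)
  have bij: "bij (\<lambda>x::nat \<Rightarrow> int. x(j := x j - 1))" for j :: nat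
    by (rule o_bij[OF shift_inv])
  note uni = wcomp_unitary[OF shift_inv, of "weyl_phase \<Theta> j" for j, folded weyl_gen_def]
  have c1: "cmod (weyl_phase \<Theta> j x) = 1" for j x by (simp add: weyl_phase_def)
  have W: "weyl_gen \<Theta> j \<in> unitaries" for j
    using uni[OF c1] by (simp add: unitaries_def adj_algebra_simps weyl_gen_def)
  have "qcomm (\<Theta> $$ (j, k)) (weyl_gen \<Theta> j) (weyl_gen \<Theta> k)" if j: "j < n" and k: "k < n" for j k
    unfolding qcomm_def
  proof (rule adj_pairs_eqI; (unfold adj_algebra_simps(1)[symmetric])?)
    let ?e = "exp (2 * pi * \<i> * \<Theta> $$ (j, k))"
    show "weyl_gen \<Theta> k \<otimes>\<^bsub>adj_algebra\<^esub> weyl_gen \<Theta> j \<in> carrier adj_algebra"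
      "?e \<odot>\<^bsub>adj_algebra\<^esub> (weyl_gen \<Theta> j \<otimes>\<^bsub>adj_algebra\<^esub> weyl_gen \<Theta> k) \<in> carrier adj_algebra"
      using unitariesD(1)[OF W] by (simp_all add: smult_closed)
    \<comment> \<open>\<open>weyl_phase_shift\<close> yields the factor cis(-\<pi> \<Theta>_kj) =
      cis(\<pi> \<Theta>_jk) in one product, by skew symmetry, and cis(-\<pi> \<Theta>_jk) in the
      other; \<open>?e\<close> is their quotient.\<close>
    have e: "cis (- (pi * \<Theta> $$ (j, k))) * ?e = cis (pi * \<Theta> $$ (j, k))"
      by (simp add: cis_conv_exp exp_add[symmetric] algebra_simps)
    have phase: "weyl_phase \<Theta> k x * weyl_phase \<Theta> j (x(k := x k - 1)) =
        ?e * (weyl_phase \<Theta> j x * weyl_phase \<Theta> k (x(j := x j - 1)))" for x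
      using j k by (simp add: weyl_phase_shift n skew_matsD(2)[OF skew j k] e[symmetric] mult_ac)
    have comm: "(\<lambda>x. x(j := x j - 1)) \<circ> (\<lambda>x. x(k := x k - 1)) =
        (\<lambda>x. x(k := x k - 1)) \<circ> (\<lambda>x::nat \<Rightarrow> int. x(j := x j - 1))"
      by (auto simp: fun_eq_iff)
    show "fst (weyl_gen \<Theta> k \<otimes>\<^bsub>adj_algebra\<^esub> weyl_gen \<Theta> j) =
        fst (?e \<odot>\<^bsub>adj_algebra\<^esub> (weyl_gen \<Theta> j \<otimes>\<^bsub>adj_algebra\<^esub> weyl_gen \<Theta> k))"
    proof (rule ext, rule poly_mapping_eqI)
      fix v :: "(nat \<Rightarrow> int) fin" and x
      show "poly_mapping.lookup (fst (weyl_gen \<Theta> k \<otimes>\<^bsub>adj_algebra\<^esub> weyl_gen \<Theta> j) v) x =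
        poly_mapping.lookup (fst (?e \<odot>\<^bsub>adj_algebra\<^esub> (weyl_gen \<Theta> j \<otimes>\<^bsub>adj_algebra\<^esub> weyl_gen \<Theta> k)) v) x"
        unfolding adj_algebra_simps weyl_gen_def fst_conv o_apply lookup_cscale
          wcomp_wcomp[OF bij bij] lookup_wcomp[OF bij_comp[OF bij bij]] comm phase
        by (simp only: mult.assoc)
    qed
  qed
  then show ?thesis by (simp add: torus_tuple_iff W n)
qed

text \<open>The universal seminorm of \<one> is at least the operator norm of the identity in the
  representation by \<open>weyl_gen\<close>, which is positive on a nonzero space.\<close>

lemma nc_torus_one_neq_zero:
  assumes "\<Theta> \<in> skew_mats n"
  shows "\<one>\<^bsub>nc_torus \<Theta>\<^esub> \<noteq> \<zero>\<^bsub>nc_torus \<Theta>\<^esub>"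
proof
  interpret bounded_relations "dim_row \<Theta>" "torus_relations \<Theta>" by (rule torus_bounded_relations)
  interpret B: unital_star_algebra "adj_algebra :: (((nat \<Rightarrow> int) fin \<Rightarrow> (nat \<Rightarrow> int) fin) \<times> _) star_algebra"
    by (rule adj_unital_star_algebra)
  let ?h = "B.eval_free (weyl_gen \<Theta>)" and ?p = "\<lambda>a::((nat \<Rightarrow> int) fin \<Rightarrow> _) \<times> ((nat \<Rightarrow> int) fin \<Rightarrow> (nat \<Rightarrow> int) fin). onorm (fst a)"
  have B: "seminormed_star_algebra adj_algebra ?p"
    by (intro seminormed_star_algebra.intro seminormed_star_algebra_axioms.intro
        adj_unital_star_algebra adj_cstar_seminorm)
  have W: "torus_tuple \<Theta> adj_algebra (weyl_gen \<Theta>)" by (rule weyl_gen_torus_tuple[OF assms])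
  then have c: "weyl_gen \<Theta> j \<in> carrier adj_algebra" if "j < dim_row \<Theta>" for j
    using that by (simp add: torus_tuple_def)
  note ev = B.eval_free_hom[of "dim_row \<Theta>" "weyl_gen \<Theta>", OF c] B.eval_free_gen[of "dim_row \<Theta>" "weyl_gen \<Theta>", OF c]
  have "torus_tuple \<Theta> adj_algebra (\<lambda>j. ?h (free_gen j))"
    by (rule torus_tuple_cong[THEN iffD2, OF _ W]) (rule ev(2))
  then have hR: "?h r = \<zero>\<^bsub>adj_algebra\<^esub>" if "r \<in> torus_relations \<Theta>" for r
    using hom_torus_relations_iff[OF adj_unital_star_algebra ev(1)] that by blast
  have "?h \<one>\<^bsub>F\<^esub> = \<one>\<^bsub>adj_algebra\<^esub>" using ev(1) by (simp add: unital_star_hom_def)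
  then have le: "onorm (id :: (nat \<Rightarrow> int) fin \<Rightarrow> _) \<le> us \<one>\<^bsub>F\<^esub>"
    using universal_seminorm_ge[OF B ev(1) hR F.one_closed] by (simp add: adj_algebra_simps)
  assume "\<one>\<^bsub>nc_torus \<Theta>\<^esub> = \<zero>\<^bsub>nc_torus \<Theta>\<^esub>"
  \<comment> \<open>Equality in the completion means that the two constant sequences differ by a
    null sequence.\<close>
  then have "(\<lambda>i::nat. us (\<one>\<^bsub>F\<^esub> \<ominus>\<^bsub>F\<^esub> \<zero>\<^bsub>F\<^esub>)) \<longlonglongrightarrow> 0"
    by (simp add: nc_torus_def universal_cstar_def F.Q_one F.Q_zero F.cls_eq_iff F.C_const F.N_iff)
  then have "us \<one>\<^bsub>F\<^esub> = 0" by (simp add: LIMSEQ_const_iff a_minus_def)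
  then have "onorm (\<lambda>v::(nat \<Rightarrow> int) fin. v) \<le> 0" using le by (simp add: id_def)
  then have "onorm (\<lambda>v::(nat \<Rightarrow> int) fin. v) = 0"
    using onorm_pos_le[OF bounded_linear_ident] by (rule antisym)
  then have "\<forall>v::(nat \<Rightarrow> int) fin. v = 0" by (simp add: onorm_eq_0[OF bounded_linear_ident])
  \<comment> \<open>The point mass at the origin of the lattice is a nonzero vector.\<close>
  then have "Poly_Mapping.single (\<lambda>_. 0) 1 = (0 :: (nat \<Rightarrow> int) fin)" by blast
  then have "poly_mapping.lookup (Poly_Mapping.single (\<lambda>_. 0) 1) (\<lambda>_::nat. 0::int) = (0 :: complex)"
    by (simp only: lookup_zero)
  then show False by simp
qed

section \<open>Homomorphisms between noncommutative tori\<close>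

lemma skew_matsI:
  assumes "A \<in> carrier_mat n n" "\<And>j k. \<lbrakk>j < n; k < n\<rbrakk> \<Longrightarrow> A $$ (k, j) = - A $$ (j, k)"
  shows "A \<in> skew_mats n"
proof -
  have "transpose_mat A = - A" using assms(1) by (intro eq_matI) (auto intro: assms(2))
  then show ?thesis using assms(1) by (simp add: skew_mats_def)
qed

text \<open>The entry is the form of A on columns j and k of B, written as the double sum of
  \<open>torus_monom_qcomm\<close>.\<close>

lemma mat_congruence_index:
  fixes A B :: "'a::comm_semiring_0 mat"
  assumes A: "A \<in> carrier_mat n n" and B: "B \<in> carrier_mat n m" and jk: "j < m" "k < m"
  shows "(transpose_mat B * A * B) $$ (j, k) = (\<Sum>a<n. \<Sum>b<n. B $$ (a, j) * A $$ (a, b) * B $$ (b, k))"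
proof -
  have "(transpose_mat B * A * B) $$ (j, k) = (transpose_mat B * (A * B)) $$ (j, k)"
    using A B by (simp add: assoc_mult_mat[of _ m n _ n _ m])
  also have "\<dots> = (\<Sum>a<n. B $$ (a, j) * (\<Sum>b<n. A $$ (a, b) * B $$ (b, k)))"
    using A B jk by (simp add: scalar_prod_def atLeast0LessThan)
  finally show ?thesis by (simp add: sum_distrib_left mult.assoc)
qed

text \<open>The transpose of B^t A B is B^t A^t B; entrywise this is an exchange of the two
  sums.\<close>

lemma mat_congruence_skew:
  fixes A B :: "'a::comm_ring_1 mat"
  assumes A: "A \<in> skew_mats n" and B: "B \<in> carrier_mat n m"
  shows "transpose_mat B * A * B \<in> skew_mats m"
proof (rule skew_matsI)
  note Ac = skew_matsD(1)[OF A]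
  show "transpose_mat B * A * B \<in> carrier_mat m m" using Ac B by simp
  fix j k assume jk: "j < m" "k < m"
  have "(transpose_mat B * A * B) $$ (k, j) = (\<Sum>b<n. \<Sum>a<n. B $$ (a, k) * A $$ (a, b) * B $$ (b, j))"
    unfolding mat_congruence_index[OF Ac B jk(2,1)] by (rule sum.swap)
  also have "\<dots> = (\<Sum>b<n. \<Sum>a<n. - (B $$ (b, j) * A $$ (b, a) * B $$ (a, k)))"
  proof (intro sum.cong refl)
    fix a b assume "b \<in> {..<n}" "a \<in> {..<n}"
    then have "A $$ (a, b) = - A $$ (b, a)" by (intro skew_matsD(2)[OF A]) simp_all
    then show "B $$ (a, k) * A $$ (a, b) * B $$ (b, j) = - (B $$ (b, j) * A $$ (b, a) * B $$ (a, k))"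
      by (simp add: mult_ac)
  qed
  finally show "(transpose_mat B * A * B) $$ (k, j) = - (transpose_mat B * A * B) $$ (j, k)"
    by (simp add: mat_congruence_index[OF Ac B jk] sum_negf)
qed

text \<open>A difference of skew matrices is skew, so integrality of the entries suffices: the
  integer witness inherits skew symmetry because \<open>real_of_int\<close> is injective.\<close>

lemma cong_skew_iff:
  assumes A: "A \<in> skew_mats m" and B: "B \<in> skew_mats m"
  shows "cong_skew m A B \<longleftrightarrow> (\<forall>j<m. \<forall>k<m. A $$ (j, k) - B $$ (j, k) \<in> \<int>)"
proof
  note c = skew_matsD(1)[OF A] skew_matsD(1)[OF B]
  assume "cong_skew m A B"
  then obtain N where N: "N \<in> skew_mats m" "A - B = map_mat real_of_int N" by (auto simp: cong_skew_def)
  have "A $$ (j, k) - B $$ (j, k) = of_int (N $$ (j, k))" if "j < m" "k < m" for j k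
    using arg_cong[OF N(2), of "\<lambda>X. X $$ (j, k)"] that c skew_matsD(1)[OF N(1)] by simp
  then show "\<forall>j<m. \<forall>k<m. A $$ (j, k) - B $$ (j, k) \<in> \<int>" by simp
next
  note c = skew_matsD(1)[OF A] skew_matsD(1)[OF B]
  assume int: "\<forall>j<m. \<forall>k<m. A $$ (j, k) - B $$ (j, k) \<in> \<int>"
  \<comment> \<open>The entries are integers by assumption, so the floor is exact.\<close>
  define N where "N = mat m m (\<lambda>(j, k). \<lfloor>A $$ (j, k) - B $$ (j, k)\<rfloor>)"
  have N: "of_int (N $$ (j, k)) = A $$ (j, k) - B $$ (j, k)" if "j < m" "k < m" for j k
    using int that by (simp add: N_def)
  have Nc: "N \<in> carrier_mat m m" by (simp add: N_def)
  have "N \<in> skew_mats m"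
  proof (rule skew_matsI)
    fix j k assume jk: "j < m" "k < m"
    have "real_of_int (N $$ (k, j)) = real_of_int (- N $$ (j, k))"
      using skew_matsD(2)[OF A jk] skew_matsD(2)[OF B jk] by (simp add: N jk)
    then show "N $$ (k, j) = - N $$ (j, k)" by (simp only: of_int_eq_iff)
  qed (rule Nc)
  moreover have "A - B = map_mat real_of_int N"
    using c Nc by (intro eq_matI) (simp_all add: N)
  ultimately show "cong_skew m A B" by (auto simp: cong_skew_def)
qed

section \<open>Existence of the homomorphism and necessity of the congruence\<close>

theorem proposition2p4:
  fixes m n :: nat and \<Theta> \<Psi> :: "real mat"
  assumes "m \<ge> 2" and "n \<ge> 2"
    and "\<Theta> \<in> skew_mats m" and "\<Psi> \<in> skew_mats n"
  shows "(\<forall>M \<in> carrier_mat n m. \<forall>z \<in> carrier_vec m.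
      (\<forall>j<m. z $ j \<in> sphere 0 1) \<longrightarrow>
      cong_skew m \<Theta> (transpose_mat (map_mat real_of_int M) * \<Psi> * map_mat real_of_int M) \<longrightarrow>
      (\<exists>\<phi> \<in> unital_star_hom (nc_torus \<Theta>) (nc_torus \<Psi>).
        \<forall>j<m. \<phi> (torus_gen \<Theta> j) =
          z $ j \<odot>\<^bsub>nc_torus \<Psi>\<^esub> torus_monom \<Psi> (M *\<^sub>v unit_vec m j)))
    \<and>
    (\<forall>\<phi> \<in> star_hom (nc_torus \<Theta>) (nc_torus \<Psi>). \<forall>M \<in> carrier_mat n m. \<forall>z \<in> carrier_vec m.
      (\<forall>j<m. z $ j \<in> sphere 0 1) \<longrightarrow>
      (\<forall>j<m. \<phi> (torus_gen \<Theta> j) =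
          z $ j \<odot>\<^bsub>nc_torus \<Psi>\<^esub> torus_monom \<Psi> (M *\<^sub>v unit_vec m j)) \<longrightarrow>
      cong_skew m \<Theta> (transpose_mat (map_mat real_of_int M) * \<Psi> * map_mat real_of_int M))"
proof (intro conjI ballI impI)
  interpret B: unital_star_algebra "nc_torus \<Psi>"
    by (rule unital_cstar_algebra.axioms(1)[OF nc_torus_cstar])
  interpret A: unital_star_algebra "nc_torus \<Theta>"
    by (rule unital_cstar_algebra.axioms(1)[OF nc_torus_cstar])
  note \<Theta> = assms(3) and \<Psi> = assms(4)
  have dim: "dim_row \<Theta> = m" "dim_row \<Psi> = n" using skew_matsD(1)[OF \<Theta>] skew_matsD(1)[OF \<Psi>] by auto
  fix M :: "int mat" and z :: "complex vec"
  assume M: "M \<in> carrier_mat n m" and z: "\<forall>j<m. z $ j \<in> sphere 0 1"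
  let ?M = "map_mat real_of_int M"
  let ?P = "transpose_mat ?M * \<Psi> * ?M"
  \<comment> \<open>The prescribed images of the generators. Their unitarity and their exponents
    \<open>?P\<close> serve both directions.\<close>
  define b where "b j = z $ j \<odot>\<^bsub>nc_torus \<Psi>\<^esub> torus_monom \<Psi> (M *\<^sub>v unit_vec m j)" for j
  have cong_iff: "cong_skew m \<Theta> ?P \<longleftrightarrow> (\<forall>j<m. \<forall>k<m. \<Theta> $$ (j, k) - ?P $$ (j, k) \<in> \<int>)"
    using M by (intro cong_skew_iff \<Theta> mat_congruence_skew[OF \<Psi>]) simp
  have mon: "torus_monom \<Psi> x \<in> B.unitaries" for x by (rule torus_monom_unitary)
  then have b: "b j \<in> B.unitaries" if "j < m" for j
    using that z by (simp add: b_def B.unitaries_smult)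
  have bb: "B.qcomm (?P $$ (j, k)) (b j) (b k)" if jk: "j < m" "k < m" for j k
  proof -
    have "?P $$ (j, k) = (\<Sum>a<n. \<Sum>c<n. ?M $$ (a, j) * \<Psi> $$ (a, c) * ?M $$ (c, k))"
      by (rule mat_congruence_index[OF skew_matsD(1)[OF \<Psi>] _ jk]) (use M in simp)
    also have "\<dots> = (\<Sum>a<n. \<Sum>c<n. of_int ((M *\<^sub>v unit_vec m j) $ a) * \<Psi> $$ (a, c) *
        of_int ((M *\<^sub>v unit_vec m k) $ c))"
      \<comment> \<open>M e_j is column j of M.\<close>
      using M jk by (intro sum.cong refl) simp
    finally show ?thesis
      using torus_monom_qcomm[of \<Psi> "M *\<^sub>v unit_vec m j" "M *\<^sub>v unit_vec m k"]
      unfolding b_def dim by (intro B.qcomm_smult B.unitariesD(1)[OF mon]) (simp only:)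
  qed
  {
    assume "cong_skew m \<Theta> ?P"
    then have "exp (2 * complex_of_real pi * \<i> * complex_of_real (\<Theta> $$ (j, k))) =
        exp (2 * complex_of_real pi * \<i> * complex_of_real (?P $$ (j, k)))" if "j < m" "k < m" for j k
      using that unfolding exp_two_pi_i_eq_iff cong_iff by blast
    \<comment> \<open>The exponents \<Theta> and \<open>?P\<close> give the same phase, so the b_j
      satisfy the relations of the torus of \<Theta>.\<close>
    then have "B.qcomm (\<Theta> $$ (j, k)) (b j) (b k)" if "j < m" "k < m" for j k
      using bb[OF that] that unfolding B.qcomm_def by simp
    then have "torus_tuple \<Theta> (nc_torus \<Psi>) b" by (simp add: B.torus_tuple_iff dim b)
    from nc_torus_universal[OF nc_torus_cstar this]
    show "\<exists>\<phi> \<in> unital_star_hom (nc_torus \<Theta>) (nc_torus \<Psi>). \<forall>j<m. \<phi> (torus_gen \<Theta> j) =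
        z $ j \<odot>\<^bsub>nc_torus \<Psi>\<^esub> torus_monom \<Psi> (M *\<^sub>v unit_vec m j)"
      by (simp add: b_def dim)
  next
    fix \<phi> assume \<phi>: "\<phi> \<in> star_hom (nc_torus \<Theta>) (nc_torus \<Psi>)"
      and "\<forall>j<m. \<phi> (torus_gen \<Theta> j) = z $ j \<odot>\<^bsub>nc_torus \<Psi>\<^esub> torus_monom \<Psi> (M *\<^sub>v unit_vec m j)"
    then have \<phi>_gen: "\<phi> (torus_gen \<Theta> j) = b j" if "j < m" for j using that by (simp add: b_def)
    \<comment> \<open>Apply \<phi> to the relations of the generators. Here \<phi> is not assumed
      unital; the b_j are unitary by their formula.\<close>
    have "B.qcomm (\<Theta> $$ (j, k)) (b j) (b k)" if jk: "j < m" "k < m" for j k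
    proof -
      have gen: "A.qcomm (\<Theta> $$ (j, k)) (torus_gen \<Theta> j) (torus_gen \<Theta> k)"
        "torus_gen \<Theta> j \<in> carrier (nc_torus \<Theta>)" "torus_gen \<Theta> k \<in> carrier (nc_torus \<Theta>)"
        using nc_torus_relations[of \<Theta>] jk A.unitariesD(1) by (auto simp: A.torus_tuple_iff dim)
      show ?thesis using arg_cong[OF gen(1)[unfolded A.qcomm_def], of \<phi>] gen(2,3) jk
        by (simp add: star_homD[OF \<phi>] B.qcomm_def \<phi>_gen)
    qed
    \<comment> \<open>The same unitaries commute with exponent \<Theta> and with exponent
      \<open>?P\<close>; as \<one> \<noteq> \<zero> in the torus of \<Psi>, the exponents differ by
      an integer.\<close>
    then have "\<Theta> $$ (j, k) - ?P $$ (j, k) \<in> \<int>" if "j < m" "k < m" for j k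
      using that by (intro B.qcomm_unique[OF b b _ bb nc_torus_one_neq_zero[OF \<Psi>]])
    then show "cong_skew m \<Theta> ?P" unfolding cong_iff by blast
  }
qed

end
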